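(* Let $\{w_n\}_{n\in\mathbb{N}}$ and $\{a_n\}_{n\in\mathbb{N}}$ be two sequences in $\mathbb{R}_+=(0,\infty)$ (with $\mathbb{N}=\{1,2,\dots\}$) such that (i) $a_n>a_{n+1}$ for all $n\in\mathbb{N}$; (ii) $\lim_{k\to\infty}a_k=0$ and $\lim_{k\to\infty}\frac{a_ka_{k+1}(a_k+a_{k+1})}{(a_k-a_{k+1})^2}=0$; (iii) $\sum_{n=1}^\infty w_n=1$ and $\sum_{n=1}^\infty w_na_n^{-1}<\infty$. Let $\nu=\sum_{n=1}^\infty w_n\delta_{a_n}$, and let $\nu^{-1}$ be the push-forward of $\nu$ under $x\mapsto 1/x$. Then for every $t>0$, neither $\sigma_t\boxtimes\nu$ nor $\sigma_t\boxtimes\nu^{-1}$ is log-unimodal.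
   Context: $\mathbb{R}_+=(0,\infty)$. Unimodality: a positive Borel measure $\mu$ on $\mathbb{R}$ is unimodal with mode $a\in\mathbb{R}$ if $\mu=c\,\delta_a+f(x)\,dx$ where $c\in[0,\infty]$ and $f:\mathbb{R}\to[0,\infty)$ is non-decreasing on $(-\infty,a)$ and non-increasing on $(a,\infty)$. A positive Borel measure $\mu$ on $\mathbb{R}_+$ is log-unimodal with mode $a\in\mathbb{R}_+$ if its push-forward $\log_*\mu$ under $\log:\mathbb{R}_+\to\mathbb{R}$ is unimodal with mode $\log a$; it is log-unimodal if this holds for some $a\in\mathbb{R}_+$. Free multiplicative convolution: for a probability measure $\mu$ on $\mathbb{R}_+$ put $\psi_\mu(z)=\int_0^\infty\frac{xz}{1-xz}\,d\mu(x)$ for $z\in\mathbb{C}\setminus[0,\infty)$ and $\eta_\mu=\psi_\mu/(1+\psi_\mu)$. The function $\eta_\mu$ has an analytic compositional inverse $\eta_\mu^{-1}$ in a neighborhood of $(-\infty,0)$, and the $\Sigma$-transform is $\Sigma_\mu(z)=\eta_\mu^{-1}(z)/z$; it determines $\mu$ uniquely. For probability measures $\mu,\nu$ on $\mathbb{R}_+$, $\mu\boxtimes\nu$ is the probability measure on $\mathbb{R}_+$ determined by $\Sigma_{\mu\boxtimes\nu}(z)=\Sigma_\mu(z)\Sigma_\nu(z)$ for $z\in(-\infty,0)$ (equivalently, it is the distribution of $X^{1/2}YX^{1/2}$ for freely independent non-negative self-adjoint operators $X,Y$ affiliated with a finite von Neumann algebra, with distributions $\mu,\nu$). Free positive multiplicative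 Brownian motion: for $t>0$, $\sigma_t$ is the ($\boxtimes$-infinitely divisible) probability measure on $\mathbb{R}_+$ with $\Sigma_{\sigma_t}(z)=\exp\left(\frac t2\cdot\frac{z+1}{z-1}\right)$. *)

theory Defs
  imports "HOL-Probability.Probability"
begin

text \<open>
  A measure on the half-line \<open>(0,\<infinity>)\<close> is represented by a Borel measure on the real line that gives
  no mass to \<open>(-\<infinity>,0]\<close>.
\<close>

definition prob_measure_pos :: "real measure \<Rightarrow> bool" where
  "prob_measure_pos \<mu> \<longleftrightarrow> prob_space \<mu> \<and> sets \<mu> = sets borel \<and> (AE x in \<mu>. 0 < x)"


section \<open>Unimodality\<close>

definition unimodal_with_mode :: "real measure \<Rightarrow> real \<Rightarrow> bool" where
  "unimodal_with_mode \<mu> a \<longleftrightarrow> sets \<mu> = sets borel \<and>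
     (\<exists>(c::ennreal) (f::real \<Rightarrow> real).
        (\<forall>x. 0 \<le> f x) \<and> mono_on {..<a} f \<and> antimono_on {a<..} f \<and>
        (\<forall>A\<in>sets borel. emeasure \<mu> A = c * indicator A a + (\<integral>\<^sup>+x\<in>A. ennreal (f x) \<partial>lborel)))"

text \<open>
  Meant for measures on \<open>(0,\<infinity>)\<close> in the above sense: the values of \<^const>\<open>ln\<close> outside
  \<open>(0,\<infinity>)\<close> are then irrelevant for the push-forward.
\<close>

definition log_unimodal_with_mode :: "real measure \<Rightarrow> real \<Rightarrow> bool" where
  "log_unimodal_with_mode \<mu> a \<longleftrightarrow> 0 < a \<and> unimodal_with_mode (distr \<mu> borel ln) (ln a)"

definition log_unimodal :: "real measure \<Rightarrow> bool" where
  "log_unimodal \<mu> \<longleftrightarrow> (\<exists>a. log_unimodal_with_mode \<mu> a)"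


section \<open>The \<open>\<Sigma>\<close>-transform and free multiplicative convolution\<close>

text \<open>\<open>psi_transform \<mu> z\<close> and \<open>eta_transform \<mu> z\<close> are only meaningful for \<open>z\<close> outside \<open>[0,\<infinity>)\<close>.\<close>

definition psi_transform :: "real measure \<Rightarrow> complex \<Rightarrow> complex" where
  "psi_transform \<mu> z = (\<integral>x. (of_real x * z) / (1 - of_real x * z) \<partial>\<mu>)"

definition eta_transform :: "real measure \<Rightarrow> complex \<Rightarrow> complex" where
  "eta_transform \<mu> z = psi_transform \<mu> z / (1 + psi_transform \<mu> z)"

definition neg_reals :: "complex set" where
  "neg_reals = complex_of_real ` {..<0}"

text \<open>
  For a probability measure on \<open>(0,\<infinity>)\<close>, \<^const>\<open>eta_transform\<close> restricts to a bijection of the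
  negative half-axis onto itself. Its inverse there is the restriction of the analytic inverse
  \<open>\<eta>\<^sup>-\<^sup>1\<close> defined in a neighbourhood of the negative half-axis, so the following is the
  \<open>\<Sigma>\<close>-transform for \<open>z\<close> in \<^const>\<open>neg_reals\<close>. Outside that set the value is junk.
\<close>

definition Sigma_transform :: "real measure \<Rightarrow> complex \<Rightarrow> complex" where
  "Sigma_transform \<mu> z = the_inv_into neg_reals (eta_transform \<mu>) z / z"

text \<open>
  \<open>is_free_mult_conv \<mu> \<nu> \<rho>\<close> says \<open>\<rho> = \<mu> \<boxtimes> \<nu>\<close>, for probability measures \<open>\<mu>\<close>, \<open>\<nu>\<close> on \<open>(0,\<infinity>)\<close>. It is a
  relation because existence and uniqueness of \<open>\<rho>\<close> are theorems of free probability. The same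
  remark applies to \<open>is_free_mult_BM t \<sigma>\<close>, which says \<open>\<sigma> = \<sigma>\<^sub>t\<close>.
\<close>

definition is_free_mult_conv :: "real measure \<Rightarrow> real measure \<Rightarrow> real measure \<Rightarrow> bool" where
  "is_free_mult_conv \<mu> \<nu> \<rho> \<longleftrightarrow> prob_measure_pos \<rho> \<and>
     (\<forall>z\<in>neg_reals. Sigma_transform \<rho> z = Sigma_transform \<mu> z * Sigma_transform \<nu> z)"

definition is_free_mult_BM :: "real \<Rightarrow> real measure \<Rightarrow> bool" where
  "is_free_mult_BM t \<sigma> \<longleftrightarrow> prob_measure_pos \<sigma> \<and>
     (\<forall>z\<in>neg_reals. Sigma_transform \<sigma> z = exp (of_real (t / 2) * ((z + 1) / (z - 1))))"


section \<open>Weighted sums of point masses\<close>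

definition atomic_measure :: "(nat \<Rightarrow> real) \<Rightarrow> (nat \<Rightarrow> real) \<Rightarrow> real measure" where
  "atomic_measure w a = distr (density (count_space UNIV) (\<lambda>n. ennreal (w n))) borel a"

lemma sets_atomic_measure [simp]: "sets (atomic_measure w a) = sets borel"
  by (simp add: atomic_measure_def)

lemma emeasure_atomic_measure:
  assumes "A \<in> sets borel"
  shows "emeasure (atomic_measure w a) A = (\<Sum>n. ennreal (w n) * indicator A (a n))"
proof -
  have "emeasure (atomic_measure w a) A
      = (\<integral>\<^sup>+n. ennreal (w n) * indicator (a -` A) n \<partial>count_space UNIV)"
    using assms by (simp add: atomic_measure_def emeasure_distr emeasure_density)
  also have "\<dots> = (\<Sum>n. ennreal (w n) * indicator A (a n))"
    by (simp add: nn_integral_count_space_nat indicator_def)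
  finally show ?thesis .
qed

end

theory Submission
  imports Defs "HOL-Complex_Analysis.Complex_Analysis"
begin

text \<open>
  The idea is that \<open>\<sigma>\<^sub>t \<boxtimes> \<nu>\<close> inherits a gap in its support from \<open>\<nu>\<close>, whereas a log-unimodal measure
  cannot have a gap with mass on both sides.

  In terms of the Herglotz transform \<open>k\<^sub>\<mu>(z) = \<integral> (1 + x z) / (1 - x z) d\<mu>(x)\<close> one has
  \<open>\<eta>\<^sub>\<mu> = (k\<^sub>\<mu> - 1) / (k\<^sub>\<mu> + 1)\<close>, and then \<open>(\<eta>\<^sub>\<mu> + 1) / (\<eta>\<^sub>\<mu> - 1) = - k\<^sub>\<mu>\<close>. The equation
  \<open>\<Sigma>\<^sub>\<rho> = \<Sigma>\<^sub>\<sigma> \<Sigma>\<^sub>\<nu>\<close> that defines \<open>\<rho> = \<sigma>\<^sub>t \<boxtimes> \<nu>\<close> therefore becomes an explicit subordination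
  \<open>k\<^sub>\<rho>(H(w)) = k\<^sub>\<nu>(w)\<close> with \<open>H(w) = w exp (- t k\<^sub>\<nu>(w) / 2)\<close> for \<open>w < 0\<close>
  (\<open>free_mult_BM_subordinated\<close>).

  Let \<open>1 / p\<close> lie in a gap of the support of \<open>\<nu>\<close> and suppose \<open>t \<integral> x p / (1 - x p)\<^sup>2 d\<nu>(x) < 1\<close>.
  Since \<open>w H'(w) / H(w) = 1 - t \<integral> x w / (1 - x w)\<^sup>2 d\<nu>(x)\<close>, this says that \<open>H\<close> is increasing near
  \<open>p\<close>. The same bound keeps \<open>arg H\<close> strictly between \<open>0\<close> and \<open>2 \<pi>\<close> on the slit annulus
  around \<open>|w| = p\<close>, so the identity \<open>k\<^sub>\<rho> \<circ> H = k\<^sub>\<nu>\<close> continues from the negative axis to the whole slit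
  annulus. Comparing imaginary parts next to the slit bounds a Poisson-type integral of \<open>\<rho>\<close> near
  \<open>1 / H(p)\<close>, so \<open>\<rho>\<close> has no mass there (\<open>subordination_gap.gap\<close>).

  To see that \<open>\<rho>\<close> has mass on both sides of this gap when \<open>\<nu>\<close> has atoms on both sides of \<open>1 / p\<close>,
  suppose that \<open>\<rho>\<close> lives below \<open>1 / q\<close>, where \<open>q = H(p)\<close>. Then \<open>k\<^sub>\<rho>\<close> is analytic on the disc of radius
  \<open>q\<close>, and so is the inverse subordination \<open>G(z) = z exp (t k\<^sub>\<rho>(z) / 2)\<close>, which maps \<open>[0, q]\<close> onto
  \<open>[0, p]\<close>. The identity \<open>k\<^sub>\<nu> \<circ> G = k\<^sub>\<rho>\<close> then prevents \<open>\<nu>\<close> from having an atom above \<open>1 / p\<close>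
  (\<open>no_atom_above\<close>). The other side follows from the symmetry \<open>x \<mapsto> 1 / x\<close>, which also reduces the
  statement about \<open>\<nu>\<^sup>-\<^sup>1\<close> to the one about \<open>\<nu>\<close>.

  For the atomic measure in question \<open>1 / p\<close> is taken to be the harmonic mean of \<open>a\<^sub>k\<close> and \<open>a\<^sub>k\<^sub>+\<^sub>1\<close>;
  the integral above is then at most a constant times the gap ratio in the hypothesis, and this
  tends to \<open>0\<close> (\<open>harmonic_mean_bound\<close>).
\<close>


section \<open>The Herglotz transform of a measure on the positive half-line\<close>

definition herglotz :: "real measure \<Rightarrow> complex \<Rightarrow> complex" where
  "herglotz \<mu> z = (\<integral>x. (1 + of_real x * z) / (1 - of_real x * z) \<partial>\<mu>)"

text \<open>
  A pole-free region for the transform. A nonzero \<open>z\<close> is regular precisely if \<open>1 / z\<close> is off the closed support of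
  \<open>\<mu>\<close> in \<open>[0, \<infinity>)\<close>, and \<open>0\<close> is regular precisely if the support is bounded. The factor
  \<open>1 + x\<close> makes the bound uniform for large \<open>x\<close> and symmetric under \<open>x \<mapsto> 1 / x\<close>.
\<close>

definition regular_points :: "real measure \<Rightarrow> complex set" where
  "regular_points \<mu> = {z. \<exists>c>0. AE x in \<mu>. c * (1 + x) \<le> cmod (1 - of_real x * z)}"

locale pos_prob = prob_space \<mu> for \<mu> :: "real measure" +
  assumes sets_eq [simp, measurable_cong]: "sets \<mu> = sets borel"
    and pos: "AE x in \<mu>. 0 < x"
begin

lemma integrable_bounded:
  fixes f :: "real \<Rightarrow> 'b::{banach, second_countable_topology}"
  assumes "f \<in> borel_measurable borel" "AE x in \<mu>. norm (f x) \<le> B"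
  shows "integrable \<mu> f"
  by (rule integrable_const_bound[OF assms(2)]) (use assms(1) in measurable)

lemma norm_integral_le:
  fixes f :: "real \<Rightarrow> 'b::{banach, second_countable_topology}"
  assumes "f \<in> borel_measurable borel" "AE x in \<mu>. norm (f x) \<le> B"
  shows "norm (\<integral>x. f x \<partial>\<mu>) \<le> B"
proof -
  have "norm (\<integral>x. f x \<partial>\<mu>) \<le> (\<integral>x. norm (f x) \<partial>\<mu>)"
    by (rule integral_norm_bound)
  also have "\<dots> \<le> (\<integral>x. B \<partial>\<mu>)"
    using integrable_bounded[OF assms] assms by (intro integral_mono_AE) auto
  finally show ?thesis by (simp add: prob_space)
qed

lemma regular_pointsE:
  assumes "z \<in> regular_points \<mu>"
  obtains c where "c > 0" "AE x in \<mu>. 0 < x \<and> c * (1 + x) \<le> cmod (1 - of_real x * z)"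
proof -
  from assms obtain c where c: "c > 0" "AE x in \<mu>. c * (1 + x) \<le> cmod (1 - of_real x * z)"
    by (auto simp: regular_points_def)
  from c(2) pos have "AE x in \<mu>. 0 < x \<and> c * (1 + x) \<le> cmod (1 - of_real x * z)"
    by eventually_elim auto
  with c that show ?thesis by blast
qed

lemma regular_perturb:
  fixes x c :: real
  assumes "c * (1 + x) \<le> cmod (1 - of_real x * z)" "0 < x" "0 < c" "cmod (z' - z) \<le> c / 2"
  shows "c / 2 * (1 + x) \<le> cmod (1 - of_real x * z')"
proof -
  have "cmod (1 - of_real x * z) \<le> cmod (1 - of_real x * z') + cmod (of_real x * (z' - z))"
    by (rule order_trans[OF _ norm_triangle_ineq]) (simp add: algebra_simps)
  also have "cmod (of_real x * (z' - z)) = x * cmod (z' - z)"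
    using assms by (simp add: norm_mult)
  also have "\<dots> \<le> x * (c / 2)" using assms by (intro mult_left_mono) auto
  finally have "c * (1 + x) \<le> cmod (1 - of_real x * z') + x * (c / 2)" using assms by simp
  moreover have "c / 2 * (1 + x) \<le> c * (1 + x) - x * (c / 2)" using assms by (simp add: field_simps)
  ultimately show ?thesis by linarith
qed

lemma open_regular_points: "open (regular_points \<mu>)"
  unfolding open_dist
proof (intro ballI)
  fix z assume "z \<in> regular_points \<mu>"
  then obtain c where c: "c > 0" "AE x in \<mu>. 0 < x \<and> c * (1 + x) \<le> cmod (1 - of_real x * z)"
    by (rule regular_pointsE)
  show "\<exists>e>0. \<forall>y. dist y z < e \<longrightarrow> y \<in> regular_points \<mu>"
  proof (intro exI[of _ "c / 2"] conjI allI impI)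
    fix y assume "dist y z < c / 2"
    then have "AE x in \<mu>. c / 2 * (1 + x) \<le> cmod (1 - of_real x * y)"
      using c(2) by (elim eventually_mono) (rule regular_perturb, use c(1) in \<open>auto simp: dist_norm\<close>)
    then show "y \<in> regular_points \<mu>" using c(1) by (auto simp: regular_points_def intro!: exI[of _ "c / 2"])
  qed (use c in auto)
qed

text \<open>
  If \<open>Re z < 0 = Im z\<close> both terms of \<open>1 - x z\<close> are positive. Otherwise the imaginary parts of
  \<open>1 - x z\<close> and of its rotation by \<open>cnj z\<close> give one bound that grows with \<open>x\<close> and one that is constant.
\<close>

lemma regular_off_nonneg_Reals:
  assumes "z \<notin> \<real>\<^sub>\<ge>\<^sub>0"
  shows "z \<in> regular_points \<mu>"
proof -
  have "\<exists>c>0. \<forall>x>0. c * (1 + x) \<le> cmod (1 - of_real x * z)"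
  proof (cases "Im z = 0")
    case True
    with assms have neg: "Re z < 0" by (auto simp: complex_nonneg_Reals_iff)
    have "min 1 (- Re z) * (1 + x) \<le> cmod (1 - of_real x * z)" if "x > 0" for x
    proof -
      have "min 1 (- Re z) * (1 + x) = min 1 (- Re z) * 1 + min 1 (- Re z) * x" by (simp add: algebra_simps)
      also have "\<dots> \<le> 1 * 1 + (- Re z) * x" using that by (intro add_mono mult_right_mono) auto
      also have "\<dots> = Re (1 - of_real x * z)" by simp
      also have "\<dots> \<le> cmod (1 - of_real x * z)" by (rule complex_Re_le_cmod)
      finally show ?thesis .
    qed
    then show ?thesis using neg by (intro exI[of _ "min 1 (- Re z)"]) auto
  next
    case False
    define m where "m = min \<bar>Im z\<bar> (\<bar>Im z\<bar> / cmod z)"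
    have z0: "cmod z > 0" using False by auto
    have m: "m > 0" using False z0 by (simp add: m_def)
    have "m / 2 * (1 + x) \<le> cmod (1 - of_real x * z)" if "x > 0" for x
    proof -
      have 1: "x * \<bar>Im z\<bar> \<le> cmod (1 - of_real x * z)"
        using abs_Im_le_cmod[of "1 - of_real x * z"] that by (simp add: abs_mult)
      have "cnj z * (1 - of_real x * z) = cnj z - of_real (x * (cmod z)\<^sup>2)"
        by (simp add: algebra_simps complex_norm_square[symmetric])
      then have "\<bar>Im z\<bar> = \<bar>Im (cnj z * (1 - of_real x * z))\<bar>" by simp
      also have "\<dots> \<le> cmod z * cmod (1 - of_real x * z)"
        using abs_Im_le_cmod[of "cnj z * (1 - of_real x * z)"] by (simp add: norm_mult)
      finally have 2: "\<bar>Im z\<bar> / cmod z \<le> cmod (1 - of_real x * z)" using z0 by (simp add: field_simps)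
      have "m * x \<le> \<bar>Im z\<bar> * x" using that by (intro mult_right_mono) (auto simp: m_def)
      moreover have "m \<le> \<bar>Im z\<bar> / cmod z" by (simp add: m_def)
      ultimately show ?thesis using 1 2 by (simp add: algebra_simps)
    qed
    then show ?thesis using m by (intro exI[of _ "m / 2"]) auto
  qed
  then obtain c where "c > 0" "\<forall>x>0. c * (1 + x) \<le> cmod (1 - of_real x * z)" by blast
  moreover from this(2) have "AE x in \<mu>. c * (1 + x) \<le> cmod (1 - of_real x * z)"
    using pos by (auto elim: eventually_mono)
  ultimately show ?thesis unfolding regular_points_def by blast
qed

lemma regular_ne:
  assumes "0 < x" "0 < c" "c * (1 + x) \<le> cmod (1 - of_real x * z)"
  shows "1 - of_real x * z \<noteq> 0"
proof -
  have "0 < c * (1 + x)" using assms by simp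
  then have "0 < cmod (1 - of_real x * z)" using assms(3) by linarith
  then show ?thesis by simp
qed

lemma regular_bounds:
  assumes "z \<in> regular_points \<mu>"
  obtains c where "c > 0"
    "AE x in \<mu>. 0 < x \<and> 1 - of_real x * z \<noteq> 0 \<and> 1 / cmod (1 - of_real x * z) \<le> 1 / c
        \<and> x / cmod (1 - of_real x * z) \<le> 1 / c"
proof -
  obtain c where c: "c > 0" "AE x in \<mu>. 0 < x \<and> c * (1 + x) \<le> cmod (1 - of_real x * z)"
    using assms by (rule regular_pointsE)
  have "AE x in \<mu>. 0 < x \<and> 1 - of_real x * z \<noteq> 0 \<and> 1 / cmod (1 - of_real x * z) \<le> 1 / c
        \<and> x / cmod (1 - of_real x * z) \<le> 1 / c"
    using c(2)
  proof eventually_elim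
    case (elim x)
    have "1 - of_real x * z \<noteq> 0" using regular_ne[of x c z] elim c by auto
    moreover from this have "cmod (1 - of_real x * z) > 0" by simp
    moreover have "c \<le> c * (1 + x)" "c * x \<le> c * (1 + x)" using c elim by auto
    ultimately have "c \<le> cmod (1 - of_real x * z)" "c * x \<le> cmod (1 - of_real x * z)" "cmod (1 - of_real x * z) > 0"
      using elim by linarith+
    then show ?case using elim c(1) \<open>1 - of_real x * z \<noteq> 0\<close> by (simp add: divide_simps mult.commute)
  qed
  with c that show ?thesis by blast
qed

lemma integrable_resolvent:
  assumes "z \<in> regular_points \<mu>"
  shows "integrable \<mu> (\<lambda>x. 1 / (1 - of_real x * z))"
proof -
  obtain c where "c > 0" and c: "AE x in \<mu>. 0 < x \<and> 1 - of_real x * z \<noteq> 0 \<and> 1 / cmod (1 - of_real x * z) \<le> 1 / c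
        \<and> x / cmod (1 - of_real x * z) \<le> 1 / c" using assms by (rule regular_bounds)
  from c have "AE x in \<mu>. norm (1 / (1 - of_real x * z)) \<le> 1 / c" by (auto simp: norm_divide elim: eventually_mono)
  then show ?thesis by (rule integrable_bounded[rotated]) measurable
qed

lemma integrable_kernel:
  assumes "z \<in> regular_points \<mu>"
  shows "integrable \<mu> (\<lambda>x. x / (cmod (1 - of_real x * z))\<^sup>2)"
    and "integrable \<mu> (\<lambda>x. of_real x / (1 - of_real x * z)\<^sup>2 :: complex)"
proof -
  obtain c where "c > 0" and c: "AE x in \<mu>. 0 < x \<and> 1 - of_real x * z \<noteq> 0 \<and> 1 / cmod (1 - of_real x * z) \<le> 1 / c
        \<and> x / cmod (1 - of_real x * z) \<le> 1 / c" using assms by (rule regular_bounds)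
  have *: "AE x in \<mu>. 0 < x \<and> x / (cmod (1 - of_real x * z))\<^sup>2 \<le> 1 / c * (1 / c)" using c
  proof eventually_elim
    case (elim x)
    then have "x / cmod (1 - of_real x * z) * (1 / cmod (1 - of_real x * z)) \<le> 1 / c * (1 / c)"
      using \<open>c > 0\<close> by (intro mult_mono) auto
    then show ?case using elim by (simp add: power2_eq_square)
  qed
  from * have 1: "AE x in \<mu>. norm (x / (cmod (1 - of_real x * z))\<^sup>2) \<le> 1 / c * (1 / c)" by (auto elim: eventually_mono)
  from * have 2: "AE x in \<mu>. norm (of_real x / (1 - of_real x * z)\<^sup>2) \<le> 1 / c * (1 / c)"
    by (auto simp: norm_divide norm_power elim: eventually_mono)
  show "integrable \<mu> (\<lambda>x. x / (cmod (1 - of_real x * z))\<^sup>2)"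
    by (rule integrable_bounded[OF _ 1]) measurable
  show "integrable \<mu> (\<lambda>x. of_real x / (1 - of_real x * z)\<^sup>2 :: complex)"
    by (rule integrable_bounded[OF _ 2]) measurable
qed

lemma herglotz_resolvent:
  assumes "z \<in> regular_points \<mu>"
  shows "herglotz \<mu> z = 2 * (\<integral>x. 1 / (1 - of_real x * z) \<partial>\<mu>) - 1"
proof -
  obtain c where "c > 0" and c: "AE x in \<mu>. 0 < x \<and> 1 - of_real x * z \<noteq> 0 \<and> 1 / cmod (1 - of_real x * z) \<le> 1 / c
        \<and> x / cmod (1 - of_real x * z) \<le> 1 / c" using assms by (rule regular_bounds)
  have "herglotz \<mu> z = (\<integral>x. 2 * (1 / (1 - of_real x * z)) - 1 \<partial>\<mu>)"
    unfolding herglotz_def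
  proof (rule integral_cong_AE)
    show "AE x in \<mu>. (1 + of_real x * z) / (1 - of_real x * z) = 2 * (1 / (1 - of_real x * z)) - 1"
      using c by eventually_elim (auto simp: field_simps)
  qed measurable
  also have "\<dots> = (\<integral>x. 2 * (1 / (1 - of_real x * z)) \<partial>\<mu>) - 1"
    using integrable_resolvent[OF assms] by (subst Bochner_Integration.integral_diff) (auto simp: prob_space simp del: times_divide_eq_right)
  also have "\<dots> = 2 * (\<integral>x. 1 / (1 - of_real x * z) \<partial>\<mu>) - 1"
    by (simp only: integral_mult_right_zero)
  finally show ?thesis .
qed

text \<open>
  Twice the resolvent \<open>1 / (1 - x z)\<close> differs from the integrand by \<open>1\<close>, and its difference
  quotient differs from the derivative by \<open>O(y - z)\<close>, uniformly in \<open>x\<close>.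
\<close>

lemma has_field_derivative_herglotz:
  assumes "z \<in> regular_points \<mu>"
  shows "(herglotz \<mu> has_field_derivative 2 * (\<integral>x. of_real x / (1 - of_real x * z)\<^sup>2 \<partial>\<mu>)) (at z)"
proof -
  obtain c where c: "c > 0" "AE x in \<mu>. 0 < x \<and> c * (1 + x) \<le> cmod (1 - of_real x * z)"
    using assms by (rule regular_pointsE)
  define D where "D = 2 * (\<integral>x. of_real x / (1 - of_real x * z)\<^sup>2 \<partial>\<mu> :: complex)"
  have est: "cmod ((herglotz \<mu> y - herglotz \<mu> z) / (y - z) - D) \<le> 4 / c ^ 3 * cmod (y - z)"
    if y: "cmod (y - z) \<le> c / 2" "y \<noteq> z" for y
  proof -
    have AEy: "AE x in \<mu>. c / 2 * (1 + x) \<le> cmod (1 - of_real x * y)"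
      using c(2) by (elim eventually_mono) (rule regular_perturb, use c(1) y in auto)
    then have ry: "y \<in> regular_points \<mu>" using c(1) by (auto simp: regular_points_def intro!: exI[of _ "c / 2"])
    have int: "integrable \<mu> (\<lambda>x. 1 / (1 - of_real x * y))" "integrable \<mu> (\<lambda>x. 1 / (1 - of_real x * z))"
      "integrable \<mu> (\<lambda>x. of_real x / (1 - of_real x * z)\<^sup>2 :: complex)"
      using integrable_resolvent[OF assms] integrable_resolvent[OF ry] integrable_kernel(2)[OF assms] by auto
    have "(herglotz \<mu> y - herglotz \<mu> z) / (y - z) - D
        = 2 * (((\<integral>x. 1 / (1 - of_real x * y) \<partial>\<mu>) - (\<integral>x. 1 / (1 - of_real x * z) \<partial>\<mu>)) / (y - z)
           - (\<integral>x. of_real x / (1 - of_real x * z)\<^sup>2 \<partial>\<mu>))"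
      using y by (simp add: herglotz_resolvent[OF assms] herglotz_resolvent[OF ry] D_def field_simps)
    also have "((\<integral>x. 1 / (1 - of_real x * y) \<partial>\<mu>) - (\<integral>x. 1 / (1 - of_real x * z) \<partial>\<mu>)) / (y - z)
           - (\<integral>x. of_real x / (1 - of_real x * z)\<^sup>2 \<partial>\<mu>)
        = (\<integral>x. (1 / (1 - of_real x * y) - 1 / (1 - of_real x * z)) / (y - z) - of_real x / (1 - of_real x * z)\<^sup>2 \<partial>\<mu>)"
      using int by simp
    finally have eq: "(herglotz \<mu> y - herglotz \<mu> z) / (y - z) - D = 2 * \<dots>" by simp
    have "norm (\<integral>x. (1 / (1 - of_real x * y) - 1 / (1 - of_real x * z)) / (y - z) - of_real x / (1 - of_real x * z)\<^sup>2 \<partial>\<mu>)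
      \<le> 2 / c ^ 3 * cmod (y - z)"
    proof (rule norm_integral_le)
      show "AE x in \<mu>. cmod ((1 / (1 - of_real x * y) - 1 / (1 - of_real x * z)) / (y - z) - of_real x / (1 - of_real x * z)\<^sup>2)
          \<le> 2 / c ^ 3 * cmod (y - z)"
        using c(2) AEy
      proof eventually_elim
        case (elim x)
        have ne: "1 - of_real x * y \<noteq> 0" "1 - of_real x * z \<noteq> 0"
          using regular_ne[of x "c/2" y] regular_ne[of x c z] elim c by auto
        have "(1 / (1 - of_real x * y) - 1 / (1 - of_real x * z)) = (of_real x * (y - z)) / ((1 - of_real x * y) * (1 - of_real x * z))"
          using ne by (simp add: divide_simps) (simp add: algebra_simps)
        then have "(1 / (1 - of_real x * y) - 1 / (1 - of_real x * z)) / (y - z)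
            = of_real x / ((1 - of_real x * y) * (1 - of_real x * z))" using y by simp
        also have "\<dots> - of_real x / (1 - of_real x * z)\<^sup>2 =
            of_real (x * x) * (y - z) / ((1 - of_real x * y) * (1 - of_real x * z)\<^sup>2)"
          using ne by (simp add: divide_simps power2_eq_square) (simp add: algebra_simps)
        also have "cmod \<dots> = x * x * cmod (y - z) / (cmod (1 - of_real x * y) * (cmod (1 - of_real x * z))\<^sup>2)"
          by (simp add: norm_mult norm_divide norm_power)
        also have "\<dots> \<le> x * x * cmod (y - z) / ((c / 2 * (1 + x)) * (c * (1 + x))\<^sup>2)"
          using elim c ne by (intro divide_left_mono mult_mono power_mono mult_pos_pos zero_less_power) auto
        also have "\<dots> = (2 / c ^ 3 * cmod (y - z)) * (x * x / (1 + x) ^ 3)"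
          using c elim by (simp add: divide_simps) (simp add: power2_eq_square power3_eq_cube)
        also have "\<dots> \<le> (2 / c ^ 3 * cmod (y - z)) * 1"
        proof (rule mult_left_mono)
          have "x * x \<le> (1 + x) ^ 2" using elim by (simp add: power2_eq_square algebra_simps)
          also have "\<dots> \<le> (1 + x) ^ 3" using elim by (intro power_increasing) auto
          finally show "x * x / (1 + x) ^ 3 \<le> 1" using elim by simp
        qed (use c in auto)
        finally show ?case by simp
      qed
    qed measurable
    then show ?thesis unfolding eq by (simp add: norm_mult)
  qed
  have "((\<lambda>y. (herglotz \<mu> y - herglotz \<mu> z) / (y - z) - D) \<longlongrightarrow> 0) (at z)"
  proof (rule Lim_null_comparison)
    show "\<forall>\<^sub>F y in at z. norm ((herglotz \<mu> y - herglotz \<mu> z) / (y - z) - D) \<le> 4 / c ^ 3 * cmod (y - z)"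
      unfolding eventually_at using c(1) est by (intro exI[of _ "c / 2"]) (auto simp: dist_norm)
    show "((\<lambda>y. 4 / c ^ 3 * cmod (y - z)) \<longlongrightarrow> 0) (at z)" using c(1) by (auto intro!: tendsto_eq_intros)
  qed
  then show ?thesis unfolding has_field_derivative_iff D_def[symmetric] by (simp add: LIM_zero_iff)
qed

lemma herglotz_holomorphic: "herglotz \<mu> holomorphic_on regular_points \<mu>"
  using has_field_derivative_herglotz by (auto simp: holomorphic_on_def field_differentiable_def intro: has_field_derivative_at_within)

text \<open>
  By the next lemmas this integral controls the imaginary part of the transform off the real line
  and its derivative on the real line; the proof of the theorem compares the two.
\<close>

definition poisson :: "complex \<Rightarrow> real" where
  "poisson z = (\<integral>x. x / (cmod (1 - of_real x * z))\<^sup>2 \<partial>\<mu>)"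

lemma poisson_nonneg: "0 \<le> poisson z"
  unfolding poisson_def by (rule integral_nonneg_AE) (use pos in \<open>auto elim!: eventually_mono\<close>)

lemma Im_herglotz:
  assumes "z \<in> regular_points \<mu>"
  shows "Im (herglotz \<mu> z) = 2 * Im z * poisson z"
proof -
  have "Im (herglotz \<mu> z) = 2 * Im (\<integral>x. 1 / (1 - of_real x * z) \<partial>\<mu>)"
    by (simp add: herglotz_resolvent[OF assms])
  also have "Im (\<integral>x. 1 / (1 - of_real x * z) \<partial>\<mu>) = (\<integral>x. Im (1 / (1 - of_real x * z)) \<partial>\<mu>)"
    using integrable_resolvent[OF assms] by simp
  also have "\<dots> = (\<integral>x. Im z * (x / (cmod (1 - of_real x * z))\<^sup>2) \<partial>\<mu>)"
    by (intro Bochner_Integration.integral_cong) (auto simp: Im_divide cmod_power2)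
  also have "\<dots> = Im z * poisson z"
    unfolding poisson_def by (simp only: integral_mult_right_zero)
  finally show ?thesis by simp
qed

lemma cmod_one_minus: "cmod (1 - of_real x * of_real r) = \<bar>1 - x * r\<bar>"
  by (metis norm_of_real of_real_1 of_real_diff of_real_mult real_norm_def)

lemma rotate_kernel:
  assumes "0 < x" "0 \<le> r" "cmod z = r"
  shows "cmod (1 - of_real x * of_real r) \<le> cmod (1 - of_real x * z)"
proof -
  have "cmod (1 - of_real x * of_real r) = \<bar>cmod 1 - cmod (of_real x * z)\<bar>"
    using assms by (simp add: norm_mult cmod_one_minus)
  also have "\<dots> \<le> cmod (1 - of_real x * z)" by (rule norm_triangle_ineq3)
  finally show ?thesis .
qed

lemma regular_rotate:
  assumes "of_real (cmod z) \<in> regular_points \<mu>"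
  shows "z \<in> regular_points \<mu>"
proof -
  obtain c where c: "c > 0" "AE x in \<mu>. 0 < x \<and> c * (1 + x) \<le> cmod (1 - of_real x * of_real (cmod z))"
    using assms by (rule regular_pointsE)
  have "AE x in \<mu>. c * (1 + x) \<le> cmod (1 - of_real x * z)"
    using c(2) by eventually_elim (use rotate_kernel[OF _ norm_ge_zero refl] order_trans in blast)
  then show ?thesis using c(1) by (auto simp: regular_points_def)
qed

text \<open>
  On a circle around the origin, \<open>|1 - x z|\<close> is smallest at the positive real point.
\<close>

lemma poisson_rotate:
  assumes "of_real (cmod z) \<in> regular_points \<mu>"
  shows "poisson z \<le> poisson (of_real (cmod z))"
  unfolding poisson_def
proof (rule integral_mono_AE)
  obtain c where c: "c > 0" "AE x in \<mu>. 0 < x \<and> c * (1 + x) \<le> cmod (1 - of_real x * of_real (cmod z))"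
    using assms by (rule regular_pointsE)
  show "AE x in \<mu>. x / (cmod (1 - of_real x * z))\<^sup>2 \<le> x / (cmod (1 - of_real x * of_real (cmod z)))\<^sup>2"
    using c(2)
  proof eventually_elim
    case (elim x)
    then have "0 < cmod (1 - of_real x * of_real (cmod z))" using regular_ne[of x c "of_real (cmod z)"] c(1) by auto
    moreover have "cmod (1 - of_real x * of_real (cmod z)) \<le> cmod (1 - of_real x * z)"
      using rotate_kernel[OF _ norm_ge_zero refl] elim by blast
    ultimately show ?case using elim by (intro divide_left_mono power_mono mult_pos_pos zero_less_power) auto
  qed
qed (use integrable_kernel[OF assms] integrable_kernel[OF regular_rotate[OF assms]] in auto)

lemma herglotz_deriv_real:
  assumes "of_real r \<in> regular_points \<mu>"
  shows "(herglotz \<mu> has_field_derivative of_real (2 * poisson (of_real r))) (at (of_real r))"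
proof -
  have "(\<integral>x. of_real x / (1 - of_real x * of_real r)\<^sup>2 \<partial>\<mu>) = (\<integral>x. complex_of_real (x / (1 - x * r)\<^sup>2) \<partial>\<mu>)"
    by simp
  also have "\<dots> = of_real (\<integral>x. x / (1 - x * r)\<^sup>2 \<partial>\<mu>)" by (rule integral_complex_of_real)
  also have "(\<integral>x. x / (1 - x * r)\<^sup>2 \<partial>\<mu>) = poisson (of_real r)" unfolding poisson_def
    by (simp only: cmod_one_minus power2_abs)
  finally show ?thesis using has_field_derivative_herglotz[OF assms] by simp
qed

lemma isCont_poisson_real:
  assumes "of_real r \<in> regular_points \<mu>"
  shows "isCont (\<lambda>r. poisson (of_real r)) r"
proof -
  have "deriv (herglotz \<mu>) holomorphic_on regular_points \<mu>"
    by (intro holomorphic_deriv herglotz_holomorphic open_regular_points)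
  then have "isCont (deriv (herglotz \<mu>)) (of_real r)"
    using holomorphic_on_imp_continuous_on open_regular_points assms continuous_on_eq_continuous_at by blast
  then have "isCont (\<lambda>s. deriv (herglotz \<mu>) (of_real s)) r"
    by (rule isCont_o2[rotated]) (rule continuous_of_real[OF continuous_ident])
  then have 1: "isCont (\<lambda>s. Re (deriv (herglotz \<mu>) (of_real s)) / 2) r" by (intro isCont_divide isCont_Re continuous_const) auto
  have "open ((of_real :: real \<Rightarrow> complex) -` regular_points \<mu>)"
    by (intro open_vimage open_regular_points continuous_intros)
  then have "\<forall>\<^sub>F s in nhds r. of_real s \<in> regular_points \<mu>"
    using assms by (auto simp: eventually_nhds)
  then have 2: "\<forall>\<^sub>F s in nhds r. Re (deriv (herglotz \<mu>) (of_real s)) / 2 = poisson (of_real s)"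
    by eventually_elim (simp add: DERIV_imp_deriv[OF herglotz_deriv_real])
  show ?thesis by (rule iffD1[OF isCont_cong[OF 2] 1])
qed

text \<open>
  Regularity of a positive real point means that its reciprocal lies in an open gap of the support.
\<close>

lemma regular_of_gap:
  assumes "0 < p" "b * p < 1" "1 < a * p" "AE x in \<mu>. x \<le> b \<or> a \<le> x"
  shows "of_real p \<in> regular_points \<mu>"
proof -
  define c where "c = min ((1 - b * p) / (1 + \<bar>b\<bar>)) ((p - 1 / a) / (1 + 1 / a))"
  have a: "0 < a" using assms(1,3) by (metis less_trans zero_less_one zero_less_mult_pos2)
  define k where "k = 1 + 1 / a"
  have k: "0 < k" "0 < p - 1 / a" using assms(3) a by (auto simp: k_def add_pos_pos divide_less_eq mult.commute)
  then have c: "0 < c" using assms(2) by (simp add: c_def k_def add_pos_nonneg)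
  have "AE x in \<mu>. c * (1 + x) \<le> cmod (1 - of_real x * of_real p)"
    using assms(4) pos
  proof eventually_elim
    case (elim x)
    have eq: "cmod (1 - of_real x * of_real p) = \<bar>1 - x * p\<bar>"
      by (rule cmod_one_minus)
    from elim(1) show ?case
    proof
      assume x: "x \<le> b"
      have "c * (1 + x) \<le> (1 - b * p) / (1 + \<bar>b\<bar>) * (1 + \<bar>b\<bar>)"
        using assms x elim c by (intro mult_mono) (auto simp: c_def)
      also have "\<dots> = 1 - b * p" using elim by simp
      also have "\<dots> \<le> 1 - x * p" using x assms by simp
      finally show ?thesis unfolding eq by linarith
    next
      assume x: "a \<le> x"
      have "1 + x \<le> x * (1 + 1 / a)" using x a by (simp add: distrib_left)
      then have "c * (1 + x) \<le> (p - 1 / a) / (1 + 1 / a) * (x * (1 + 1 / a))"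
        using elim k by (intro mult_mono) (auto simp: c_def k_def)
      also have "\<dots> = x * (p - 1 / a)" using k(1) by (simp add: k_def[symmetric])
      also have "\<dots> \<le> x * p - 1" using x a elim by (simp add: field_simps)
      finally show ?thesis unfolding eq by linarith
    qed
  qed
  then show ?thesis using c by (auto simp: regular_points_def)
qed

text \<open>
  An atom makes the integral blow up quadratically at the reciprocal point.
\<close>

lemma poisson_atom:
  assumes "z \<in> regular_points \<mu>" "0 < a"
  shows "measure \<mu> {a} * (a / (cmod (1 - of_real a * z))\<^sup>2) \<le> poisson z"
proof -
  have "measure \<mu> {a} * (a / (cmod (1 - of_real a * z))\<^sup>2) = (\<integral>x. indicator {a} x * (a / (cmod (1 - of_real a * z))\<^sup>2) \<partial>\<mu>)"
    by (simp only: integral_mult_left_zero) simp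
  also have "\<dots> \<le> poisson z" unfolding poisson_def
  proof (rule integral_mono_AE)
    show "integrable \<mu> (\<lambda>x. indicator {a} x * (a / (cmod (1 - of_real a * z))\<^sup>2))"
      by (intro integrable_mult_left integrable_real_indicator) (auto simp: emeasure_eq_measure)
    show "AE x in \<mu>. indicator {a} x * (a / (cmod (1 - of_real a * z))\<^sup>2) \<le> x / (cmod (1 - of_real x * z))\<^sup>2"
      using pos by eventually_elim (auto simp: indicator_def)
  qed (rule integrable_kernel(1)[OF assms(1)])
  finally show ?thesis .
qed

lemma herglotz_cnj: "herglotz \<mu> (cnj z) = cnj (herglotz \<mu> z)"
proof -
  have "herglotz \<mu> (cnj z) = (\<integral>x. cnj ((1 + of_real x * z) / (1 - of_real x * z)) \<partial>\<mu>)"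
    by (simp add: herglotz_def complex_cnj_divide)
  then show ?thesis by (simp only: Bochner_Integration.integral_cnj herglotz_def)
qed

lemma herglotz_of_real: "herglotz \<mu> (of_real r) = of_real (\<integral>x. (1 + x * r) / (1 - x * r) \<partial>\<mu>)"
proof -
  have "herglotz \<mu> (of_real r) = (\<integral>x. of_real ((1 + x * r) / (1 - x * r)) \<partial>\<mu>)"
    by (simp add: herglotz_def)
  then show ?thesis by (simp only: integral_complex_of_real)
qed

end

section \<open>The subordination relation on the negative half-line\<close>

context pos_prob
begin

lemma neg_regular: "0 < s \<Longrightarrow> - of_real s \<in> regular_points \<mu>"
  by (rule regular_off_nonneg_Reals) (simp add: complex_nonneg_Reals_iff)

text \<open>
  All transforms are real on the negative half-axis, where they are functions of this quantity:
  \<open>k = 2 R - 1\<close> and \<open>\<eta> = 1 - 1 / R\<close> at \<open>- s\<close>. It decreases from \<open>1\<close> to \<open>0\<close>, so that \<open>\<eta>\<close> is a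
  bijection of the negative half-axis.
\<close>

definition resolvent_mean :: "real \<Rightarrow> real" where
  "resolvent_mean s = (\<integral>x. 1 / (1 + x * s) \<partial>\<mu>)"

lemma resolvent_in_unit_interval: assumes "0 < s" shows "AE x in \<mu>. 0 < x \<and> 0 < 1 / (1 + x * s) \<and> 1 / (1 + x * s) < 1"
  using pos by eventually_elim (use assms in \<open>auto simp: add_pos_pos\<close>)

lemma integrable_resolvent_neg: assumes "0 < s" shows "integrable \<mu> (\<lambda>x. 1 / (1 + x * s))"
  by (rule integrable_bounded[where B = 1]) (measurable, use resolvent_in_unit_interval[OF assms] in \<open>auto elim: eventually_mono\<close>)

lemma herglotz_neg:
  assumes "0 < s"
  shows "herglotz \<mu> (- of_real s) = of_real (2 * resolvent_mean s - 1)"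
proof -
  have "(\<integral>x. 1 / (1 - of_real x * (- of_real s)) \<partial>\<mu>) = (\<integral>x. complex_of_real (1 / (1 + x * s)) \<partial>\<mu>)"
    by simp
  also have "\<dots> = of_real (resolvent_mean s)" unfolding resolvent_mean_def by (rule integral_complex_of_real)
  finally show ?thesis by (simp add: herglotz_resolvent[OF neg_regular[OF assms]])
qed

lemma resolvent_mean_bounds: assumes "0 < s" shows "0 < resolvent_mean s" "resolvent_mean s < 1"
proof -
  have "(\<integral>x. 0 \<partial>\<mu>) < resolvent_mean s" unfolding resolvent_mean_def
    by (rule integral_less_AE_space) (use integrable_resolvent_neg[OF assms] resolvent_in_unit_interval[OF assms] emeasure_space_1 in \<open>auto elim: eventually_mono\<close>)
  then show "0 < resolvent_mean s" by simp
  have "resolvent_mean s < (\<integral>x. 1 \<partial>\<mu>)" unfolding resolvent_mean_def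
    by (rule integral_less_AE_space) (use integrable_resolvent_neg[OF assms] resolvent_in_unit_interval[OF assms] emeasure_space_1 in \<open>auto elim: eventually_mono\<close>)
  then show "resolvent_mean s < 1" by (simp add: prob_space)
qed

lemma resolvent_mean_strict_antimono: assumes "0 < s" "s < r" shows "resolvent_mean r < resolvent_mean s"
  unfolding resolvent_mean_def
proof (rule integral_less_AE_space)
  show "AE x in \<mu>. 1 / (1 + x * r) < 1 / (1 + x * s)"
    using pos by eventually_elim (use assms in \<open>auto intro!: divide_strict_left_mono mult_pos_pos add_pos_pos\<close>)
qed (use integrable_resolvent_neg assms emeasure_space_1 in auto)

lemma resolvent_mean_inj: "0 < s \<Longrightarrow> 0 < r \<Longrightarrow> resolvent_mean s = resolvent_mean r \<Longrightarrow> s = r"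
  using resolvent_mean_strict_antimono[of s r] resolvent_mean_strict_antimono[of r s] by (cases s r rule: linorder_cases) auto

lemma resolvent_mean_continuous: "continuous_on {0<..} resolvent_mean"
proof -
  have "continuous_on {0<..} (\<lambda>s. herglotz \<mu> (- of_real s))"
    by (rule continuous_on_compose2[OF holomorphic_on_imp_continuous_on[OF herglotz_holomorphic]])
      (auto intro: neg_regular intro!: continuous_intros)
  then have "continuous_on {0<..} (\<lambda>s. (Re (herglotz \<mu> (- of_real s)) + 1) / 2)" by (intro continuous_intros) auto
  then show ?thesis by (rule continuous_on_eq) (simp add: herglotz_neg)
qed

lemma resolvent_mean_at_top: "(\<lambda>n. resolvent_mean (real (Suc n))) \<longlonglongrightarrow> 0"
proof -
  have "(\<lambda>n. resolvent_mean (real (Suc n))) \<longlonglongrightarrow> (\<integral>x. 0 \<partial>\<mu>)" unfolding resolvent_mean_def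
  proof (rule integral_dominated_convergence[where w = "\<lambda>_. 1"])
    show "AE x in \<mu>. (\<lambda>n. 1 / (1 + x * real (Suc n))) \<longlonglongrightarrow> 0" using pos
    proof eventually_elim
      case (elim x)
      then show ?case by real_asymp
    qed
    show "AE x in \<mu>. norm (1 / (1 + x * real (Suc n))) \<le> 1" for n
      using resolvent_in_unit_interval[of "real (Suc n)"] by (auto elim: eventually_mono)
  qed auto
  then show ?thesis by simp
qed

lemma resolvent_mean_at_0: "(\<lambda>n. resolvent_mean (1 / real (Suc n))) \<longlonglongrightarrow> 1"
proof -
  have "(\<lambda>n. resolvent_mean (1 / real (Suc n))) \<longlonglongrightarrow> (\<integral>x. 1 \<partial>\<mu>)" unfolding resolvent_mean_def
  proof (rule integral_dominated_convergence[where w = "\<lambda>_. 1"])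
    show "AE x in \<mu>. (\<lambda>n. 1 / (1 + x * (1 / real (Suc n)))) \<longlonglongrightarrow> 1"
      by (intro AE_I2) real_asymp
    show "AE x in \<mu>. norm (1 / (1 + x * (1 / real (Suc n)))) \<le> 1" for n
      using resolvent_in_unit_interval[of "1 / real (Suc n)"] by (auto elim: eventually_mono)
  qed auto
  then show ?thesis by (simp add: prob_space)
qed

lemma resolvent_mean_surj:
  assumes "0 < y" "y < 1"
  obtains s where "0 < s" "resolvent_mean s = y"
proof -
  have "\<forall>\<^sub>F n in sequentially. resolvent_mean (real (Suc n)) < y \<and> y < resolvent_mean (1 / real (Suc n))"
    using order_tendstoD(2)[OF resolvent_mean_at_top assms(1)] order_tendstoD(1)[OF resolvent_mean_at_0 assms(2)] by (rule eventually_conj)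
  then obtain n where n: "resolvent_mean (real (Suc n)) < y" "y < resolvent_mean (1 / real (Suc n))"
    using eventually_happens'[OF sequentially_bot] by blast
  have "\<exists>s\<ge>1 / real (Suc n). s \<le> real (Suc n) \<and> resolvent_mean s = y"
  proof (rule IVT2')
    show "1 / real (Suc n) \<le> real (Suc n)" by (simp add: divide_simps) (simp add: algebra_simps)
    show "continuous_on {1 / real (Suc n)..real (Suc n)} resolvent_mean"
      by (rule continuous_on_subset[OF resolvent_mean_continuous]) (auto intro: less_le_trans[of 0 "1 / real (Suc n)"])
  qed (use n in auto)
  then obtain s where "1 / real (Suc n) \<le> s" "resolvent_mean s = y" by blast
  moreover from this have "0 < s" by (auto intro: less_le_trans[of 0 "1 / real (Suc n)"])
  ultimately show ?thesis using that by blast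
qed

lemma psi_transform_eq:
  assumes "z \<in> regular_points \<mu>"
  shows "psi_transform \<mu> z = (herglotz \<mu> z - 1) / 2"
proof -
  obtain c where "c > 0" and c: "AE x in \<mu>. 0 < x \<and> 1 - of_real x * z \<noteq> 0 \<and> 1 / cmod (1 - of_real x * z) \<le> 1 / c
        \<and> x / cmod (1 - of_real x * z) \<le> 1 / c" using assms by (rule regular_bounds)
  have "psi_transform \<mu> z = (\<integral>x. 1 / (1 - of_real x * z) - 1 \<partial>\<mu>)"
    unfolding psi_transform_def
  proof (rule integral_cong_AE)
    show "AE x in \<mu>. of_real x * z / (1 - of_real x * z) = 1 / (1 - of_real x * z) - 1"
      using c by eventually_elim (auto simp: field_simps)
  qed measurable
  also have "\<dots> = (\<integral>x. 1 / (1 - of_real x * z) \<partial>\<mu>) - 1"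
    using integrable_resolvent[OF assms] by (simp add: prob_space)
  finally show ?thesis by (simp add: herglotz_resolvent[OF assms])
qed

lemma eta_transform_neg:
  assumes "0 < s"
  shows "eta_transform \<mu> (- of_real s) = of_real (1 - 1 / resolvent_mean s)"
proof -
  have "psi_transform \<mu> (- of_real s) = of_real (resolvent_mean s - 1)"
    by (simp add: psi_transform_eq[OF neg_regular[OF assms]] herglotz_neg[OF assms])
  then have "eta_transform \<mu> (- of_real s) = of_real ((resolvent_mean s - 1) / resolvent_mean s)"
    unfolding eta_transform_def by simp
  also have "(resolvent_mean s - 1) / resolvent_mean s = 1 - 1 / resolvent_mean s"
    using resolvent_mean_bounds[OF assms] by (simp add: field_simps)
  finally show ?thesis .
qed

lemma inv_eta_transform:
  assumes "0 < s"
  shows "the_inv_into neg_reals (eta_transform \<mu>) (of_real (1 - 1 / resolvent_mean s)) = - of_real s"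
proof (rule the_inv_into_f_eq)
  show "inj_on (eta_transform \<mu>) neg_reals"
  proof (rule inj_onI)
    fix x y assume "x \<in> neg_reals" "y \<in> neg_reals" and eq: "eta_transform \<mu> x = eta_transform \<mu> y"
    then obtain a b where x: "x = of_real a" "a < 0" and y: "y = of_real b" "b < 0" by (auto simp: neg_reals_def)
    then have "resolvent_mean (- a) = resolvent_mean (- b)"
      using eq eta_transform_neg[of "- a"] eta_transform_neg[of "- b"] by (simp del: of_real_diff of_real_divide)
    then show "x = y" using resolvent_mean_inj[of "- a" "- b"] x y by simp
  qed
  show "eta_transform \<mu> (- of_real s) = of_real (1 - 1 / resolvent_mean s)" by (rule eta_transform_neg[OF assms])
  show "- of_real s \<in> neg_reals" using assms by (auto simp: neg_reals_def intro!: image_eqI[of _ _ "- s"])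
qed

end

text \<open>
  The relation \<open>k\<^sub>\<rho> \<circ> H = k\<^sub>\<nu>\<close> on the negative half-axis, with \<open>H(w) = w exp (- t k\<^sub>\<nu>(w) / 2)\<close>. Everything
  that the proof uses about \<open>\<rho> = \<sigma>\<^sub>t \<boxtimes> \<nu>\<close> is contained in it.
\<close>

definition subordinated :: "real \<Rightarrow> real measure \<Rightarrow> real measure \<Rightarrow> bool" where
  "subordinated t \<nu> \<rho> \<longleftrightarrow> (\<forall>w\<in>neg_reals.
     herglotz \<rho> (w * exp (- (of_real (t / 2) * herglotz \<nu> w))) = herglotz \<nu> w)"

lemma pos_prob_iff: "prob_measure_pos \<mu> \<longleftrightarrow> pos_prob \<mu>"
  by (auto simp: prob_measure_pos_def pos_prob_def pos_prob_axioms_def)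

text \<open>
  Put \<open>z = \<eta>\<^sub>\<nu>(w)\<close>, so that \<open>(z + 1) / (z - 1) = - k\<^sub>\<nu>(w)\<close>. Multiplying the equation
  \<open>\<Sigma>\<^sub>\<rho>(z) = \<Sigma>\<^sub>\<sigma>(z) \<Sigma>\<^sub>\<nu>(z)\<close> by \<open>z\<close> gives \<open>\<eta>\<^sub>\<rho>\<^sup>-\<^sup>1(z) = H(w)\<close>. Hence \<open>\<eta>\<^sub>\<rho>(H(w)) = \<eta>\<^sub>\<nu>(w)\<close>, and \<open>\<eta>\<close>
  determines \<open>k\<close>.
\<close>

lemma free_mult_BM_subordinated:
  assumes "is_free_mult_BM t \<sigma>" "is_free_mult_conv \<sigma> \<nu> \<rho>" "pos_prob \<nu>"
  shows "subordinated t \<nu> \<rho>"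
  unfolding subordinated_def
proof
  fix w assume "w \<in> neg_reals"
  then obtain s where s: "0 < s" "w = - of_real s"
    unfolding neg_reals_def by (metis imageE lessThan_iff neg_0_less_iff_less of_real_minus minus_minus)
  interpret \<nu>: pos_prob \<nu> by fact
  interpret \<rho>: pos_prob \<rho> using assms by (simp add: is_free_mult_conv_def pos_prob_iff)
  define R where "R = \<nu>.resolvent_mean s"
  have R: "0 < R" "R < 1" using \<nu>.resolvent_mean_bounds[OF s(1)] by (auto simp: R_def)
  then obtain r where r: "0 < r" "\<rho>.resolvent_mean r = R" by (rule \<rho>.resolvent_mean_surj)
  define z where "z = complex_of_real (1 - 1 / R)"
  have zr: "1 - 1 / R < 0" using R by simp
  then have z: "z \<in> neg_reals" "z \<noteq> 0"
    unfolding neg_reals_def z_def using of_real_eq_0_iff[of "1 - 1 / R"] by (blast, metis less_irrefl)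
  have "Sigma_transform \<rho> z = Sigma_transform \<sigma> z * Sigma_transform \<nu> z"
    "Sigma_transform \<sigma> z = exp (of_real (t / 2) * ((z + 1) / (z - 1)))"
    using assms z(1) by (auto simp: is_free_mult_conv_def is_free_mult_BM_def)
  moreover have "Sigma_transform \<rho> z = - of_real r / z" "Sigma_transform \<nu> z = - of_real s / z"
    unfolding Sigma_transform_def using \<rho>.inv_eta_transform[OF r(1)] \<nu>.inv_eta_transform[OF s(1)] r(2)
    by (simp_all add: z_def R_def)
  ultimately have eq: "- of_real r = w * exp (of_real (t / 2) * ((z + 1) / (z - 1)))"
    using z(2) s(2) by (simp add: field_simps)
  have "(1 - 1 / R + 1) / (1 - 1 / R - 1) = - (2 * R - 1)" using R by (simp add: field_simps)
  moreover have "(z + 1) / (z - 1) = of_real ((1 - 1 / R + 1) / (1 - 1 / R - 1))"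
    by (simp only: z_def of_real_add of_real_diff of_real_divide of_real_1)
  ultimately have "(z + 1) / (z - 1) = of_real (- (2 * R - 1))" by metis
  also have "\<dots> = - herglotz \<nu> w" unfolding s(2) \<nu>.herglotz_neg[OF s(1)] R_def by simp
  finally have "w * exp (- (of_real (t / 2) * herglotz \<nu> w)) = - of_real r"
    unfolding eq by simp
  then show "herglotz \<rho> (w * exp (- (of_real (t / 2) * herglotz \<nu> w))) = herglotz \<nu> w"
    using \<rho>.herglotz_neg[OF r(1)] \<nu>.herglotz_neg[OF s(1)] r(2) s(2) by (simp add: R_def)
qed

section \<open>Inversion of the half-line\<close>

abbreviation (input) inv_measure :: "real measure \<Rightarrow> real measure" where
  "inv_measure \<mu> \<equiv> distr \<mu> borel (\<lambda>x. 1 / x)"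

context pos_prob
begin

lemma pos_prob_inv: "pos_prob (inv_measure \<mu>)"
proof -
  interpret I: prob_space "inv_measure \<mu>" by (rule prob_space_distr) measurable
  show ?thesis
  proof
    show "AE x in inv_measure \<mu>. 0 < x"
      using pos by (subst AE_distr_iff) (auto elim: eventually_mono)
  qed auto
qed

lemma regular_inv:
  assumes "z \<in> regular_points \<mu>" "z \<noteq> 0"
  shows "1 / z \<in> regular_points (inv_measure \<mu>)"
proof -
  obtain c where c: "c > 0" "AE x in \<mu>. 0 < x \<and> c * (1 + x) \<le> cmod (1 - of_real x * z)"
    using assms(1) by (rule regular_pointsE)
  have "AE x in \<mu>. c / cmod z * (1 + 1 / x) \<le> cmod (1 - of_real (1 / x) * (1 / z))"
    using c(2)
  proof eventually_elim
    case (elim x)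
    have "c / cmod z * (1 + 1 / x) = c * (1 + x) / (x * cmod z)" using elim assms(2) by (simp add: field_simps)
    also have "\<dots> \<le> cmod (1 - of_real x * z) / (x * cmod z)" using elim assms(2) by (intro divide_right_mono) auto
    also have "\<dots> = cmod ((1 - of_real x * z) / (of_real x * z))" using elim by (simp add: norm_divide norm_mult)
    also have "\<dots> = cmod (of_real (1 / x) * (1 / z) - 1)" using elim assms(2) by (simp add: diff_divide_distrib)
    also have "\<dots> = cmod (1 - of_real (1 / x) * (1 / z))" by (rule norm_minus_commute)
    finally show ?case .
  qed
  then have "AE x in inv_measure \<mu>. c / cmod z * (1 + x) \<le> cmod (1 - of_real x * (1 / z))"
    by (subst AE_distr_iff) auto
  then show ?thesis unfolding regular_points_def using c(1) assms(2) by (auto intro!: exI[of _ "c / cmod z"])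
qed

lemma herglotz_inv:
  assumes "z \<noteq> 0"
  shows "herglotz (inv_measure \<mu>) (1 / z) = - herglotz \<mu> z"
proof -
  have "herglotz (inv_measure \<mu>) (1 / z) = (\<integral>x. (1 + of_real (1 / x) * (1 / z)) / (1 - of_real (1 / x) * (1 / z)) \<partial>\<mu>)"
    unfolding herglotz_def by (subst integral_distr) auto
  also have "\<dots> = (\<integral>x. - ((1 + of_real x * z) / (1 - of_real x * z)) \<partial>\<mu>)"
  proof (rule integral_cong_AE)
    show "AE x in \<mu>. (1 + of_real (1 / x) * (1 / z)) / (1 - of_real (1 / x) * (1 / z)) = - ((1 + of_real x * z) / (1 - of_real x * z))"
      using pos
    proof eventually_elim
      case (elim x)
      have "(1 + of_real (1 / x) * (1 / z)) / (1 - of_real (1 / x) * (1 / z)) = (1 + of_real x * z) / (of_real x * z - 1)"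
        using elim assms by (cases "of_real x * z = 1") (simp_all add: field_simps)
      also have "of_real x * z - 1 = - (1 - of_real x * z)" by simp
      finally show ?case by (simp only: divide_minus_right)
    qed
  qed measurable
  finally show ?thesis by (simp add: herglotz_def)
qed

lemma measure_inv_atom:
  assumes "0 < a"
  shows "measure (inv_measure \<mu>) {1 / a} = measure \<mu> {a}"
proof -
  have "measure (inv_measure \<mu>) {1 / a} = measure \<mu> ((\<lambda>x. 1 / x) -` {1 / a} \<inter> space \<mu>)"
    by (rule measure_distr) auto
  also have "(\<lambda>x. 1 / x) -` {1 / a} \<inter> space \<mu> = {a}"
    using assms sets_eq_imp_space_eq[OF sets_eq] by (auto simp: field_simps)
  finally show ?thesis .
qed

lemma poisson_inv:
  assumes "0 < p"
  shows "1 / p * pos_prob.poisson (inv_measure \<mu>) (of_real (1 / p)) = p * poisson (of_real p)"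
proof -
  interpret inv: pos_prob "inv_measure \<mu>" by (rule pos_prob_inv)
  have "1 / p * inv.poisson (of_real (1 / p)) = (\<integral>x. 1 / p * (1 / x / (1 - 1 / x * (1 / p))\<^sup>2) \<partial>\<mu>)"
    unfolding inv.poisson_def cmod_one_minus power2_abs by (subst integral_distr) (auto simp del: times_divide_eq_right times_divide_eq_left)
  also have "\<dots> = (\<integral>x. p * (x / (1 - x * p)\<^sup>2) \<partial>\<mu>)"
  proof (rule integral_cong_AE)
    show "AE x in \<mu>. 1 / p * (1 / x / (1 - 1 / x * (1 / p))\<^sup>2) = p * (x / (1 - x * p)\<^sup>2)"
      using pos
    proof eventually_elim
      case (elim x)
      have "1 - 1 / x * (1 / p) = - ((1 - x * p) / (x * p))" using elim assms by (simp add: field_simps)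
      then have "(1 - 1 / x * (1 / p))\<^sup>2 = (1 - x * p)\<^sup>2 / (x * p)\<^sup>2" by (simp add: power_divide)
      then show ?case using elim assms by (simp add: power2_eq_square)
    qed
  qed measurable
  also have "\<dots> = p * poisson (of_real p)"
    unfolding poisson_def cmod_one_minus power2_abs by (simp only: integral_mult_right_zero)
  finally show ?thesis .
qed

end

text \<open>
  Inversion changes the sign of the Herglotz transform, and hence \<open>H\<close> for \<open>\<nu>\<^sup>-\<^sup>1\<close> at \<open>1 / w\<close> is the reciprocal
  of \<open>H\<close> for \<open>\<nu>\<close> at \<open>w\<close>.
\<close>

lemma subordinated_inv:
  assumes "subordinated t \<nu> \<rho>" "pos_prob \<nu>" "pos_prob \<rho>"
  shows "subordinated t (inv_measure \<nu>) (inv_measure \<rho>)"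
  unfolding subordinated_def
proof
  fix w' assume "w' \<in> neg_reals"
  define w where "w = 1 / w'"
  from \<open>w' \<in> neg_reals\<close> have w: "w \<in> neg_reals" "w \<noteq> 0" "w' = 1 / w"
    by (auto simp: neg_reals_def w_def intro!: image_eqI[of _ _ "1 / _"])
  have 1: "herglotz (inv_measure \<nu>) w' = - herglotz \<nu> w"
    unfolding w(3) by (rule pos_prob.herglotz_inv) fact+
  have 2: "w' * exp (of_real (t / 2) * herglotz \<nu> w) = 1 / (w * exp (- (of_real (t / 2) * herglotz \<nu> w)))"
    by (simp add: w(3) exp_minus divide_simps)
  have "herglotz (inv_measure \<rho>) (w' * exp (of_real (t / 2) * herglotz \<nu> w)) = - herglotz \<rho> (w * exp (- (of_real (t / 2) * herglotz \<nu> w)))"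
    unfolding 2 by (rule pos_prob.herglotz_inv) (use assms w in auto)
  then show "herglotz (inv_measure \<rho>) (w' * exp (- (of_real (t / 2) * herglotz (inv_measure \<nu>) w'))) = herglotz (inv_measure \<nu>) w'"
    using assms(1) w(1) by (simp add: 1 subordinated_def)
qed

section \<open>A gap in the support survives\<close>

text \<open>
  If balls of radius \<open>e\<close> have mass \<open>O(e\<^sup>2)\<close>, the distribution function has derivative \<open>0\<close>.
\<close>

lemma null_interval_of_quadratic:
  fixes M :: "real measure"
  assumes "finite_measure M" and [simp]: "sets M = sets borel"
    and e0: "0 < e0"
    and small: "\<And>m e. \<alpha> < m \<Longrightarrow> m < \<beta> \<Longrightarrow> 0 < e \<Longrightarrow> e \<le> e0 \<Longrightarrow> measure M {m - e..m + e} \<le> K * e\<^sup>2"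
    and y: "\<alpha> < y" "y < y'" "y' < \<beta>"
  shows "measure M {y<..y'} = 0"
proof -
  interpret finite_measure M by fact
  define F where "F y = measure M {..y}" for y
  have diff: "F v - F u = measure M {u<..v}" if "u \<le> v" for u v
  proof -
    have "F v = measure M ({..u} \<union> {u<..v})" using that by (simp add: F_def ivl_disj_un)
    also have "\<dots> = F u + measure M {u<..v}" unfolding F_def by (rule finite_measure_Union) auto
    finally show ?thesis by simp
  qed
  have bound: "\<bar>F v - F u\<bar> \<le> K / 4 * \<bar>v - u\<bar>\<^sup>2"
    if "\<alpha> < u" "u < \<beta>" "\<alpha> < v" "v < \<beta>" "\<bar>v - u\<bar> \<le> e0" for u v
    using that
  proof (induction u v rule: linorder_wlog)
    case (le u v)
    show ?case
    proof (cases "u = v")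
      case False
      define m e where "m = (u + v) / 2" and "e = (v - u) / 2"
      have "F v - F u \<le> measure M {m - e..m + e}"
        unfolding diff[OF le(1)] by (rule finite_measure_mono) (auto simp: m_def e_def field_simps)
      also have "\<dots> \<le> K * e\<^sup>2" using False le by (intro small) (auto simp: m_def e_def)
      finally show ?thesis using le diff[OF le(1)] by (simp add: e_def power_divide)
    qed simp
  qed (simp add: abs_minus_commute)
  have "F y = F y'"
  proof (rule DERIV_isconst3[of \<alpha> \<beta> y y' F])
    fix u assume u: "u \<in> {\<alpha><..<\<beta>}"
    have "((\<lambda>v. (F v - F u) / (v - u)) \<longlongrightarrow> 0) (at u)"
    proof (rule Lim_null_comparison)
      define d where "d = min e0 (min (u - \<alpha>) (\<beta> - u))"
      have eq: "K / 4 * w\<^sup>2 / w = K / 4 * w" for w :: real by (simp add: power2_eq_square)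
      have "d > 0" using u e0 by (auto simp: d_def)
      moreover have "norm ((F v - F u) / (v - u)) \<le> K / 4 * \<bar>v - u\<bar>" if "v \<noteq> u" "\<bar>v - u\<bar> < d" for v
      proof -
        have "\<bar>F v - F u\<bar> \<le> K / 4 * \<bar>v - u\<bar>\<^sup>2" by (rule bound) (use that u in \<open>auto simp: d_def abs_if split: if_splits\<close>)
        then have "\<bar>F v - F u\<bar> / \<bar>v - u\<bar> \<le> K / 4 * \<bar>v - u\<bar>\<^sup>2 / \<bar>v - u\<bar>" by (rule divide_right_mono) simp
        also have "\<dots> = K / 4 * \<bar>v - u\<bar>" using eq[of "\<bar>v - u\<bar>"] .
        finally show ?thesis by simp
      qed
      ultimately show "\<forall>\<^sub>F v in at u. norm ((F v - F u) / (v - u)) \<le> K / 4 * \<bar>v - u\<bar>"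
        unfolding eventually_at dist_real_def by blast
      show "((\<lambda>v. K / 4 * \<bar>v - u\<bar>) \<longlongrightarrow> 0) (at u)" by (rule tendsto_eq_intros refl | simp)+
    qed
    then show "DERIV F u :> 0" by (simp add: has_field_derivative_iff)
  qed (use y in auto)
  then show ?thesis using diff[of y y'] y by simp
qed

lemma exp_notin_nonneg_Reals:
  assumes "0 < Im z" "Im z < 2 * pi"
  shows "exp z \<notin> \<real>\<^sub>\<ge>\<^sub>0"
proof
  assume "exp z \<in> \<real>\<^sub>\<ge>\<^sub>0"
  then have re: "0 \<le> cos (Im z)" and im: "sin (Im z) = 0"
    by (auto simp: complex_nonneg_Reals_iff Re_exp Im_exp zero_le_mult_iff)
  consider "Im z < pi" | "Im z = pi" | "pi < Im z" by linarith
  then show False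
  proof cases
    case 1
    then show ?thesis using sin_gt_zero[OF assms(1)] im by simp
  next
    case 2
    then show ?thesis using re by simp
  next
    case 3
    then show ?thesis using sin_lt_zero[OF 3 assms(2)] im by simp
  qed
qed

text \<open>
  This is what keeps \<open>arg H\<close> inside \<open>(0, 2 \<pi>)\<close>: on a circle, \<open>arg H = \<theta> - D sin \<theta>\<close> with
  \<open>D < 1\<close>.
\<close>

lemma mult_sin_between:
  fixes \<theta> D \<kappa> :: real
  assumes "0 < \<theta>" "\<theta> < 2 * pi" "0 \<le> D" "D \<le> \<kappa>" "\<kappa> < 1"
  shows "0 < \<theta> - D * sin \<theta>" "\<theta> - D * sin \<theta> < 2 * pi"
proof -
  have *: "D * sin x < x" if "0 < x" for x
  proof (cases "0 \<le> sin x")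
    case True
    have "D * sin x \<le> \<kappa> * x" using assms that True sin_x_le_x[of x] by (intro mult_mono) auto
    also have "\<dots> < x" using assms that by simp
    finally show ?thesis .
  next
    case False
    then have "D * sin x \<le> 0" using assms by (simp add: mult_nonneg_nonpos)
    with that show ?thesis by linarith
  qed
  show "0 < \<theta> - D * sin \<theta>" using *[of \<theta>] assms by simp
  have "D * sin (2 * pi - \<theta>) < 2 * pi - \<theta>" using assms by (intro *) simp
  then show "\<theta> - D * sin \<theta> < 2 * pi" by (simp add: sin_diff)
qed

lemma mult_cos_1_le_sin:
  fixes y :: real
  assumes "0 \<le> y" "y \<le> 1"
  shows "y * cos 1 \<le> sin y"
proof (cases "y = 0")
  case False
  with assms have "0 < y" by (simp add: less_le)
  then obtain x where x: "0 < x" "x < y" "sin y - sin 0 = (y - 0) * cos x"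
    using MVT2[of 0 y sin cos] by (auto intro: DERIV_sin)
  have "cos 1 \<le> cos x" using x assms pi_gt3 by (intro cos_monotone_0_pi_le) auto
  then show ?thesis using x assms by (simp add: mult_left_mono)
qed simp

text \<open>
  A point \<open>1 / p\<close> in a gap of the support of \<open>\<nu>\<close> at which the time \<open>t\<close> is too short for the gap
  to be filled.
\<close>

locale subordination_gap = nu: pos_prob \<nu> + rho: pos_prob \<rho> for \<nu> \<rho> :: "real measure" +
  fixes t p :: real
  assumes sub: "subordinated t \<nu> \<rho>" and t: "0 < t" and p: "0 < p"
    and p_regular: "of_real p \<in> regular_points \<nu>"
    and p_small: "t * p * nu.poisson (of_real p) < 1"
begin

text \<open>
  The function \<open>H\<close> in logarithmic coordinates: \<open>exp (log_H \<zeta>) = H (exp \<zeta>)\<close>. They turn the slit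
  annulus into a rectangle and make the argument of \<open>H\<close> single-valued.
\<close>

definition log_H :: "complex \<Rightarrow> complex" where
  "log_H \<zeta> = \<zeta> - of_real (t / 2) * herglotz \<nu> (exp \<zeta>)"

text \<open>
  The strict inequality at \<open>p\<close> persists on nearby circles with a uniform constant \<open>\<kappa> < 1\<close>, because
  the integral is half the derivative of the Herglotz transform and so is continuous.
\<close>

lemma subcritical_near_p:
  obtains u1 u2 \<kappa> where "u1 < ln p" "ln p < u2" "0 < \<kappa>" "\<kappa> < 1"
    "\<And>u. u1 < u \<Longrightarrow> u < u2 \<Longrightarrow> of_real (exp u) \<in> regular_points \<nu>"
    "\<And>u. u1 < u \<Longrightarrow> u < u2 \<Longrightarrow> t * exp u * nu.poisson (of_real (exp u)) \<le> \<kappa>"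
proof -
  define \<kappa> where "\<kappa> = (1 + t * p * nu.poisson (of_real p)) / 2"
  have ge: "0 \<le> t * p * nu.poisson (of_real p)" using t p nu.poisson_nonneg by simp
  have "0 \<le> y \<Longrightarrow> y < 1 \<Longrightarrow> 0 < (1 + y) / 2 \<and> (1 + y) / 2 < 1 \<and> y < (1 + y) / 2" for y :: real by auto
  from this[OF ge p_small] have \<kappa>: "0 < \<kappa>" "\<kappa> < 1" "t * p * nu.poisson (of_real p) < \<kappa>"
    unfolding \<kappa>_def by blast+
  have c: "isCont exp (ln p)" by simp
  have e: "exp (ln p) = p" using p by simp
  have "isCont (\<lambda>u. nu.poisson (of_real (exp u))) (ln p)"
    by (rule isCont_o2[OF c]) (use nu.isCont_poisson_real[OF p_regular] e in simp)
  then have "isCont (\<lambda>u. t * exp u * nu.poisson (of_real (exp u))) (ln p)"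
    by (intro continuous_mult continuous_const c)
  then have "((\<lambda>u. t * exp u * nu.poisson (of_real (exp u))) \<longlongrightarrow> t * exp (ln p) * nu.poisson (of_real (exp (ln p)))) (nhds (ln p))"
    by (simp only: isCont_def tendsto_at_iff_tendsto_nhds[of "\<lambda>u. t * exp u * nu.poisson (of_real (exp u))"])
  then have "((\<lambda>u. t * exp u * nu.poisson (of_real (exp u))) \<longlongrightarrow> t * p * nu.poisson (of_real p)) (nhds (ln p))"
    by (simp only: e)
  then have 1: "\<forall>\<^sub>F u in nhds (ln p). t * exp u * nu.poisson (of_real (exp u)) < \<kappa>"
    using \<kappa>(3) by (rule order_tendstoD(2))
  have "open ((\<lambda>u. complex_of_real (exp u)) -` regular_points \<nu>)"
    by (intro open_vimage nu.open_regular_points continuous_intros)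
  then have 2: "\<forall>\<^sub>F u in nhds (ln p). of_real (exp u) \<in> regular_points \<nu>"
    using p_regular e by (auto simp: eventually_nhds intro!: exI[of _ "(\<lambda>u. complex_of_real (exp u)) -` regular_points \<nu>"])
  have "\<forall>\<^sub>F u in nhds (ln p). of_real (exp u) \<in> regular_points \<nu> \<and> t * exp u * nu.poisson (of_real (exp u)) \<le> \<kappa>"
    using 1 2 by eventually_elim auto
  then obtain d where d: "d > 0" "\<And>u. dist u (ln p) < d \<Longrightarrow>
      of_real (exp u) \<in> regular_points \<nu> \<and> t * exp u * nu.poisson (of_real (exp u)) \<le> \<kappa>"
    unfolding eventually_nhds_metric by blast
  show ?thesis
    by (rule that[of "ln p - d" "ln p + d" \<kappa>]) (use d \<kappa> in \<open>auto simp: dist_real_def\<close>)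
qed

end

text \<open>
  A neighbourhood of \<open>ln p\<close> on which the strict inequality holds uniformly, as supplied by
  \<open>subcritical_near_p\<close>.
\<close>

locale subordination_strip = subordination_gap +
  fixes u1 u2 \<kappa> :: real
  assumes u1: "u1 < ln p" and u2: "ln p < u2" and \<kappa>: "0 < \<kappa>" "\<kappa> < 1"
    and regular: "\<And>u. u1 < u \<Longrightarrow> u < u2 \<Longrightarrow> of_real (exp u) \<in> regular_points \<nu>"
    and small: "\<And>u. u1 < u \<Longrightarrow> u < u2 \<Longrightarrow> t * exp u * nu.poisson (of_real (exp u)) \<le> \<kappa>"
begin

lemma exp_regular:
  assumes "u1 < Re \<zeta>" "Re \<zeta> < u2"
  shows "exp \<zeta> \<in> regular_points \<nu>"
  by (rule nu.regular_rotate) (use regular[OF assms] in simp)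

lemma Im_herglotz_exp:
  assumes "u1 < Re \<zeta>" "Re \<zeta> < u2"
  obtains D where "0 \<le> D" "D \<le> \<kappa>" "Im (herglotz \<nu> (exp \<zeta>)) = 2 / t * (D * sin (Im \<zeta>))"
proof
  let ?D = "t * exp (Re \<zeta>) * nu.poisson (exp \<zeta>)"
  show "0 \<le> ?D" using t nu.poisson_nonneg by simp
  have "nu.poisson (exp \<zeta>) \<le> nu.poisson (of_real (exp (Re \<zeta>)))"
    using nu.poisson_rotate[of "exp \<zeta>"] regular[OF assms] by simp
  then have "?D \<le> t * exp (Re \<zeta>) * nu.poisson (of_real (exp (Re \<zeta>)))"
    using t by (intro mult_left_mono) auto
  also have "\<dots> \<le> \<kappa>" by (rule small[OF assms])
  finally show "?D \<le> \<kappa>" .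
  show "Im (herglotz \<nu> (exp \<zeta>)) = 2 / t * (?D * sin (Im \<zeta>))"
    using t by (simp add: nu.Im_herglotz[OF exp_regular[OF assms]] Im_exp)
qed

lemma Im_log_H:
  assumes "u1 < Re \<zeta>" "Re \<zeta> < u2"
  obtains D where "0 \<le> D" "D \<le> \<kappa>" "Im (herglotz \<nu> (exp \<zeta>)) = 2 / t * (D * sin (Im \<zeta>))"
    "Im (log_H \<zeta>) = Im \<zeta> - D * sin (Im \<zeta>)"
proof -
  obtain D where "0 \<le> D" "D \<le> \<kappa>" "Im (herglotz \<nu> (exp \<zeta>)) = 2 / t * (D * sin (Im \<zeta>))"
    using assms by (rule Im_herglotz_exp)
  with that t show ?thesis by (simp add: log_H_def)
qed

lemma log_H_holomorphic: "log_H holomorphic_on {\<zeta>. u1 < Re \<zeta> \<and> Re \<zeta> < u2}"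
  unfolding log_H_def
  by (intro holomorphic_intros holomorphic_on_compose_gen[OF _ nu.herglotz_holomorphic, unfolded o_def])
    (auto intro: exp_regular)

text \<open>
  The slit annulus in logarithmic coordinates; the negative half-axis corresponds to \<open>Im \<zeta> = \<pi>\<close>.
\<close>

definition strip :: "complex set" where
  "strip = {\<zeta>. u1 < Re \<zeta> \<and> Re \<zeta> < u2 \<and> 0 < Im \<zeta> \<and> Im \<zeta> < 2 * pi}"

lemma exp_log_H_regular: "\<zeta> \<in> strip \<Longrightarrow> exp (log_H \<zeta>) \<in> regular_points \<rho>"
proof (rule rho.regular_off_nonneg_Reals)
  assume "\<zeta> \<in> strip"
  then obtain D where "0 \<le> D" "D \<le> \<kappa>" "Im (log_H \<zeta>) = Im \<zeta> - D * sin (Im \<zeta>)"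
    unfolding strip_def using Im_log_H by blast
  then show "exp (log_H \<zeta>) \<notin> \<real>\<^sub>\<ge>\<^sub>0"
    using \<open>\<zeta> \<in> strip\<close> \<kappa> mult_sin_between[of "Im \<zeta>" D \<kappa>] by (intro exp_notin_nonneg_Reals) (auto simp: strip_def)
qed

lemma strip_convex_open: "convex strip" "open strip"
proof -
  have eq: "strip = {\<zeta>. u1 < Re \<zeta>} \<inter> {\<zeta>. Re \<zeta> < u2} \<inter> {\<zeta>. 0 < Im \<zeta>} \<inter> {\<zeta>. Im \<zeta> < 2 * pi}"
    by (auto simp: strip_def)
  show "convex strip" unfolding eq
    by (intro convex_Int convex_halfspace_Re_gt convex_halfspace_Re_lt convex_halfspace_Im_gt convex_halfspace_Im_lt)
  show "open strip" unfolding eq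
    by (intro open_Int open_halfspace_Re_gt open_halfspace_Re_lt open_halfspace_Im_gt open_halfspace_Im_lt)
qed

text \<open>
  Analytic continuation of the subordination relation from the line \<open>Im \<zeta> = \<pi>\<close>.
\<close>

lemma herglotz_exp_log_H:
  assumes "\<zeta> \<in> strip"
  shows "herglotz \<rho> (exp (log_H \<zeta>)) = herglotz \<nu> (exp \<zeta>)"
proof -
  let ?f = "\<lambda>\<zeta>. herglotz \<rho> (exp (log_H \<zeta>)) - herglotz \<nu> (exp \<zeta>)"
  let ?U = "{\<zeta> \<in> strip. Im \<zeta> = pi}"
  let ?c = "Complex (ln p) pi"
  have "?f \<zeta> = 0"
  proof (rule analytic_continuation[of ?f strip ?U ?c])
    have "log_H holomorphic_on strip" by (rule holomorphic_on_subset[OF log_H_holomorphic]) (auto simp: strip_def)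
    then show "?f holomorphic_on strip"
      by (intro holomorphic_intros holomorphic_on_compose_gen[OF _ nu.herglotz_holomorphic, unfolded o_def]
           holomorphic_on_compose_gen[OF _ rho.herglotz_holomorphic, unfolded o_def])
        (auto intro: exp_regular exp_log_H_regular simp: strip_def)
    show "open strip" "connected strip" using strip_convex_open convex_connected by auto
    show "?c \<in> strip" using u1 u2 by (auto simp: strip_def)
    show "?c islimpt ?U"
      unfolding islimpt_approachable
    proof (intro allI impI)
      fix e :: real assume e: "0 < e"
      define h where "h = min (e / 2) ((u2 - ln p) / 2)"
      have h: "0 < h" "h < e" "h < u2 - ln p" using e u2 by (auto simp: h_def min_def)
      have "Complex (ln p + h) pi \<in> ?U" using h u1 by (auto simp: strip_def)
      moreover have "Complex (ln p + h) pi \<noteq> ?c" "dist (Complex (ln p + h) pi) ?c < e"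
        using h by (auto simp: dist_norm cmod_def)
      ultimately show "\<exists>x'\<in>?U. x' \<noteq> ?c \<and> dist x' ?c < e" by blast
    qed
    fix \<zeta> assume "\<zeta> \<in> ?U"
    then have "exp \<zeta> = of_real (- exp (Re \<zeta>))" by (simp add: complex_eq_iff Re_exp Im_exp)
    then have "exp \<zeta> \<in> neg_reals" unfolding neg_reals_def by auto
    moreover have "exp (log_H \<zeta>) = exp \<zeta> * exp (- (of_real (t / 2) * herglotz \<nu> (exp \<zeta>)))"
      unfolding log_H_def diff_conv_add_uminus exp_add ..
    ultimately show "?f \<zeta> = 0" using sub by (simp only: subordinated_def) simp
  qed (use assms in auto)
  then show ?thesis by simp
qed

text \<open>
  The imaginary parts of both sides of the continued identity are \<open>2 |z| sin (Im (log_H \<zeta>))\<close> times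
  the integral for \<open>\<rho>\<close> at \<open>z = exp (log_H \<zeta>)\<close>, and at most \<open>2 \<kappa> sin \<theta> / t\<close>, where
  \<open>\<theta> = Im \<zeta>\<close>. As \<open>\<theta>\<close> tends to \<open>0\<close>, the factor \<open>sin (Im (log_H \<zeta>))\<close> is at least a multiple
  of \<open>(1 - \<kappa>) \<theta>\<close>, so the quotient stays bounded up to the slit.
\<close>

lemma poisson_bound:
  obtains C where "0 < C" "\<And>\<zeta>. \<zeta> \<in> strip \<Longrightarrow> Im \<zeta> \<le> 1 \<Longrightarrow> cmod (exp (log_H \<zeta>)) * rho.poisson (exp (log_H \<zeta>)) \<le> C"
proof
  let ?C = "\<kappa> / (t * (1 - \<kappa>) * cos 1)"
  have cos1: "0 < cos (1::real)" using pi_gt3 by (intro cos_gt_zero_pi) auto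
  show "0 < ?C" using \<kappa> t cos1 by simp
  fix \<zeta> assume \<zeta>: "\<zeta> \<in> strip" "Im \<zeta> \<le> 1"
  define \<theta> where "\<theta> = Im \<zeta>"
  have \<theta>: "0 < \<theta>" "\<theta> \<le> 1" using \<zeta> by (auto simp: \<theta>_def strip_def)
  then have sin: "0 \<le> sin \<theta>" "sin \<theta> \<le> \<theta>" using pi_gt3 by (auto intro: sin_ge_zero sin_x_le_x)
  obtain D where D: "0 \<le> D" "D \<le> \<kappa>" "Im (herglotz \<nu> (exp \<zeta>)) = 2 / t * (D * sin \<theta>)"
    "Im (log_H \<zeta>) = \<theta> - D * sin \<theta>"
    unfolding \<theta>_def using \<zeta>(1) Im_log_H unfolding strip_def by blast
  have Dsin: "0 \<le> D * sin \<theta>" "D * sin \<theta> \<le> \<kappa> * \<theta>" using D sin \<kappa> by (auto intro: mult_mono)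
  define y where "y = Im (log_H \<zeta>)"
  have y: "(1 - \<kappa>) * \<theta> \<le> y" "y \<le> 1" using Dsin \<theta> D(4) by (auto simp: y_def algebra_simps)
  have y0: "0 \<le> y" by (rule order_trans[OF _ y(1)]) (use \<kappa> \<theta> in simp)
  have "(1 - \<kappa>) * \<theta> * cos 1 \<le> y * cos 1" using y(1) cos1 by simp
  also have "\<dots> \<le> sin y" using y0 y(2) by (rule mult_cos_1_le_sin)
  finally have siny: "(1 - \<kappa>) * \<theta> * cos 1 \<le> sin y" .
  let ?z = "exp (log_H \<zeta>)"
  have nn: "0 \<le> cmod ?z * rho.poisson ?z" using rho.poisson_nonneg by simp
  have "2 * (cmod ?z * sin y) * rho.poisson ?z = Im (herglotz \<rho> ?z)"
    unfolding rho.Im_herglotz[OF exp_log_H_regular[OF \<zeta>(1)]] by (simp add: Im_exp y_def)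
  also have "\<dots> = 2 / t * (D * sin \<theta>)" using herglotz_exp_log_H[OF \<zeta>(1)] D(3) by simp
  also have "\<dots> \<le> 2 / t * (\<kappa> * \<theta>)" using Dsin t by (intro mult_left_mono) auto
  finally have "2 * ((cmod ?z * rho.poisson ?z) * sin y) \<le> 2 * (\<kappa> * \<theta> / t)" by (simp add: mult_ac)
  then have "(cmod ?z * rho.poisson ?z) * sin y \<le> \<kappa> * \<theta> / t" by linarith
  then have "(cmod ?z * rho.poisson ?z) * ((1 - \<kappa>) * \<theta> * cos 1) \<le> \<kappa> * \<theta> / t"
    using mult_left_mono[OF siny nn] by linarith
  then have "\<theta> * (t * (1 - \<kappa>) * cos 1 * (cmod ?z * rho.poisson ?z)) \<le> \<theta> * \<kappa>"
    using t by (simp add: field_simps)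
  then have "t * (1 - \<kappa>) * cos 1 * (cmod ?z * rho.poisson ?z) \<le> \<kappa>" using \<theta> by simp
  moreover have "0 < t * (1 - \<kappa>) * cos 1" using t \<kappa> cos1 by simp
  ultimately show "cmod ?z * rho.poisson ?z \<le> ?C" by (simp add: field_simps)
qed

text \<open>\<open>log_H\<close> on the real line, where it is an increasing function.\<close>

definition g :: "real \<Rightarrow> real" where
  "g u = u - t / 2 * Re (herglotz \<nu> (of_real (exp u)))"

lemma log_H_of_real: "log_H (of_real u) = of_real (g u)"
  unfolding log_H_def g_def exp_of_real nu.herglotz_of_real by simp

lemma g_deriv:
  assumes "u1 < u" "u < u2"
  obtains d where "(g has_real_derivative d) (at u)" "0 < d"
proof
  let ?P = "nu.poisson (of_real (exp u))"
  have "(herglotz \<nu> has_field_derivative of_real (2 * ?P)) (at (exp (of_real u)))"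
    unfolding exp_of_real by (rule nu.herglotz_deriv_real[OF regular[OF assms]])
  then have "((\<lambda>\<zeta>. herglotz \<nu> (exp \<zeta>)) has_field_derivative of_real (2 * ?P) * exp (of_real u)) (at (of_real u))"
    by (rule DERIV_chain2) (rule DERIV_exp)
  then have "(log_H has_field_derivative 1 - of_real (t / 2) * (of_real (2 * ?P) * exp (of_real u))) (at (of_real u))"
    unfolding log_H_def by (intro DERIV_diff DERIV_ident DERIV_cmult)
  also have "1 - of_real (t / 2) * (of_real (2 * ?P) * exp (of_real u)) = complex_of_real (1 - t * exp u * ?P)"
    unfolding exp_of_real by simp
  finally have "((\<lambda>u. Re (log_H (of_real u))) has_real_derivative Re (complex_of_real (1 - t * exp u * ?P))) (at u)"
    by (intro has_field_derivative_Re has_vector_derivative_real_field)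
  then show "(g has_real_derivative (1 - t * exp u * ?P)) (at u)" by (simp add: log_H_of_real)
  show "0 < 1 - t * exp u * ?P" using small[OF assms] \<kappa> by simp
qed

lemma log_H_tendsto:
  assumes "u1 < u" "u < u2"
  shows "(\<lambda>n. log_H (Complex u (1 / real (Suc n)))) \<longlonglongrightarrow> of_real (g u)"
proof -
  have op: "open {\<zeta>. u1 < Re \<zeta> \<and> Re \<zeta> < u2}"
    using open_Int[OF open_halfspace_Re_gt[of u1] open_halfspace_Re_lt[of u2]] by (simp add: Collect_conj_eq)
  have "isCont log_H (of_real u)"
    using holomorphic_on_imp_continuous_on[OF log_H_holomorphic] op assms by (auto simp: continuous_on_eq_continuous_at)
  moreover have "(\<lambda>n. Complex u (1 / real (Suc n))) \<longlonglongrightarrow> Complex u 0"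
    by (intro tendsto_Complex tendsto_const) real_asymp
  ultimately have "(\<lambda>n. log_H (Complex u (1 / real (Suc n)))) \<longlonglongrightarrow> log_H (of_real u)"
    by (intro isCont_tendsto_compose[of _ log_H]) (simp_all add: complex_of_real_def)
  then show ?thesis by (simp add: log_H_of_real)
qed

lemma approach_in_strip: "u1 < u \<Longrightarrow> u < u2 \<Longrightarrow> Complex u (1 / real (Suc n)) \<in> strip \<and> Im (Complex u (1 / real (Suc n))) \<le> 1"
proof -
  have "1 / real (Suc n) \<le> 1" by simp
  moreover from this have "1 / real (Suc n) < 2 * pi" using pi_gt3 by linarith
  ultimately show "u1 < u \<Longrightarrow> u < u2 \<Longrightarrow> ?thesis" by (simp add: strip_def)
qed

text \<open>
  If \<open>z\<close> is within \<open>e\<close> of \<open>exp (g u)\<close> and \<open>x\<close> within \<open>e\<close> of its reciprocal, both on the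
  logarithmic scale, then \<open>|1 - x z| \<le> 3 e\<close> and \<open>x |z| \<ge> 1 / 2\<close>. So the integrand of the bounded
  integral is at least \<open>1 / (18 e\<^sup>2)\<close> on such a ball, and Markov's inequality applies.
\<close>

lemma measure_log_ball:
  obtains K where "\<And>u e. u1 < u \<Longrightarrow> u < u2 \<Longrightarrow> 0 < e \<Longrightarrow> e \<le> 1 / 4 \<Longrightarrow>
    measure (distr \<rho> borel ln) {- g u - e..- g u + e} \<le> K * e\<^sup>2"
proof -
  obtain C where C: "0 < C" "\<And>\<zeta>. \<zeta> \<in> strip \<Longrightarrow> Im \<zeta> \<le> 1 \<Longrightarrow> cmod (exp (log_H \<zeta>)) * rho.poisson (exp (log_H \<zeta>)) \<le> C"
    using poisson_bound by blast
  have "measure (distr \<rho> borel ln) {- g u - e..- g u + e} \<le> (18 * C) * e\<^sup>2"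
    if u: "u1 < u" "u < u2" and e: "0 < e" "e \<le> 1 / 4" for u e
  proof -
    have "\<forall>\<^sub>F n in sequentially. dist (log_H (Complex u (1 / real (Suc n)))) (of_real (g u)) < e"
      using log_H_tendsto[OF u] e(1) by (rule tendstoD)
    then obtain n where n: "dist (log_H (Complex u (1 / real (Suc n)))) (of_real (g u)) < e"
      using eventually_happens'[OF sequentially_bot] by blast
    define \<zeta> where "\<zeta> = Complex u (1 / real (Suc n))"
    define z where "z = exp (log_H \<zeta>)"
    have \<zeta>: "\<zeta> \<in> strip" "Im \<zeta> \<le> 1" using approach_in_strip[OF u] by (auto simp: \<zeta>_def)
    have z: "z \<in> regular_points \<rho>" using exp_log_H_regular[OF \<zeta>(1)] by (simp add: z_def)
    obtain c where c: "c > 0" "AE x in \<rho>. 0 < x \<and> c * (1 + x) \<le> cmod (1 - of_real x * z)"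
      using z by (rule rho.regular_pointsE)
    let ?A = "ln -` {- g u - e..- g u + e} \<inter> space \<rho>"
    have A: "?A \<in> sets \<rho>" by measurable
    have "measure (distr \<rho> borel ln) {- g u - e..- g u + e} = measure \<rho> ?A"
      by (rule measure_distr) auto
    also have "\<dots> = (\<integral>x. indicator ?A x \<partial>\<rho>)" using A by simp
    also have "\<dots> \<le> (\<integral>x. 18 * e\<^sup>2 * cmod z * (x / (cmod (1 - of_real x * z))\<^sup>2) \<partial>\<rho>)"
    proof (rule integral_mono_AE)
      show "integrable \<rho> (\<lambda>x. indicator ?A x :: real)"
        using A by (intro integrable_real_indicator) (auto simp: rho.emeasure_eq_measure)
      show "integrable \<rho> (\<lambda>x. 18 * e\<^sup>2 * cmod z * (x / (cmod (1 - of_real x * z))\<^sup>2))"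
        by (intro integrable_mult_right rho.integrable_kernel(1)[OF z])
      show "AE x in \<rho>. indicator ?A x \<le> 18 * e\<^sup>2 * cmod z * (x / (cmod (1 - of_real x * z))\<^sup>2)"
        using c(2)
      proof eventually_elim
        case (elim x)
        have pos: "0 < cmod (1 - of_real x * z)" using rho.regular_ne[of x c z] elim c(1) by simp
        show ?case
        proof (cases "x \<in> ?A")
          case True
          define \<xi> where "\<xi> = of_real (ln x) + log_H \<zeta>"
          have "complex_of_real x = exp (of_real (ln x))" using elim by (simp add: exp_of_real)
          then have xz: "of_real x * z = exp \<xi>" by (simp only: \<xi>_def z_def exp_add)
          have "\<xi> = (log_H \<zeta> - of_real (g u)) + of_real (ln x + g u)" by (simp add: \<xi>_def)
          then have "cmod \<xi> \<le> cmod (log_H \<zeta> - of_real (g u)) + cmod (of_real (ln x + g u))"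
            by (simp only: norm_triangle_ineq)
          also have "cmod (of_real (ln x + g u)) = \<bar>ln x + g u\<bar>" by (rule norm_of_real)
          also have "\<bar>ln x + g u\<bar> \<le> e" using True by auto
          finally have \<xi>: "cmod \<xi> \<le> 2 * e" using n by (simp add: dist_norm \<zeta>_def)
          then have \<xi>': "cmod \<xi> \<le> 1 / 2" using e by simp
          have "cmod (1 - of_real x * z) = cmod (exp \<xi> - 1)" unfolding xz by (rule norm_minus_commute)
          also have "\<dots> \<le> 3 / 2 * cmod \<xi>" using \<xi>' by (rule norm_exp_bounds)
          also have "\<dots> \<le> 3 * e" using \<xi> by simp
          finally have small: "(cmod (1 - of_real x * z))\<^sup>2 \<le> (3 * e)\<^sup>2" by (intro power_mono) auto
          have "1 + (- 1 / 2) \<le> exp (- 1 / 2 :: real)" by (rule exp_ge_add_one_self)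
          also have "- 1 / 2 \<le> Re \<xi>" using \<xi>' abs_Re_le_cmod[of \<xi>] by linarith
          then have "exp (- 1 / 2) \<le> exp (Re \<xi>)" by simp
          also have "exp (Re \<xi>) = cmod (of_real x * z)" unfolding xz by simp
          also have "\<dots> = x * cmod z" using elim by (simp add: norm_mult)
          finally have big: "1 / 2 \<le> x * cmod z" by simp
          have "(cmod (1 - of_real x * z))\<^sup>2 \<le> 18 * e\<^sup>2 * (1 / 2)" using small by (simp add: power_mult_distrib)
          also have "\<dots> \<le> 18 * e\<^sup>2 * (x * cmod z)" using big by (intro mult_left_mono) auto
          finally have "1 \<le> 18 * e\<^sup>2 * (x * cmod z) / (cmod (1 - of_real x * z))\<^sup>2" using pos by simp
          then show ?thesis using True by (simp add: mult_ac)
        next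
          case False
          then show ?thesis using elim by simp
        qed
      qed
    qed
    also have "\<dots> = 18 * e\<^sup>2 * (cmod z * rho.poisson z)"
      unfolding rho.poisson_def by (simp only: integral_mult_right_zero mult.assoc)
    also have "\<dots> \<le> 18 * e\<^sup>2 * C" using C(2)[OF \<zeta>] by (intro mult_left_mono) (auto simp: z_def)
    finally show ?thesis by (simp add: mult_ac)
  qed
  with that show ?thesis by blast
qed

text \<open>
  The points \<open>g u\<close> fill a neighbourhood of \<open>g (ln p) = ln q\<close> because \<open>g\<close> is increasing; so the
  reciprocal of \<open>q\<close> lies in a gap of \<open>\<rho>\<close>, and the continued identity extends to the slit by continuity.
\<close>

lemma gap_of_strip:
  obtains q a b where "0 < q" "q = p * exp (- (t / 2 * Re (herglotz \<nu> (of_real p))))"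
    "0 < a" "a * q < 1" "1 < b * q" "AE x in \<rho>. x \<le> a \<or> b \<le> x"
    "of_real q \<in> regular_points \<rho>" "herglotz \<rho> (of_real q) = herglotz \<nu> (of_real p)"
proof -
  obtain K where K: "\<And>u e. u1 < u \<Longrightarrow> u < u2 \<Longrightarrow> 0 < e \<Longrightarrow> e \<le> 1 / 4 \<Longrightarrow>
    measure (distr \<rho> borel ln) {- g u - e..- g u + e} \<le> K * e\<^sup>2"
    using measure_log_ball by blast
  define v1 v2 where "v1 = (u1 + ln p) / 2" and "v2 = (ln p + u2) / 2"
  have v: "u1 < v1" "v1 < ln p" "ln p < v2" "v2 < u2" using u1 u2 by (auto simp: v1_def v2_def)
  have mono: "g x < g y" if "u1 < x" "x < y" "y < u2" for x y
  proof (rule DERIV_pos_imp_increasing[OF that(2)])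
    fix z assume "x \<le> z" "z \<le> y"
    then show "\<exists>d. DERIV g z :> d \<and> 0 < d" using g_deriv[of z] that by (metis le_less_trans less_le_trans)
  qed
  define q where "q = exp (g (ln p))"
  have q: "0 < q" by (simp add: q_def)
  have q_eq: "q = p * exp (- (t / 2 * Re (herglotz \<nu> (of_real p))))"
    using p unfolding q_def g_def diff_conv_add_uminus exp_add by simp
  interpret M: prob_space "distr \<rho> borel ln" by (rule rho.prob_space_distr) auto
  \<comment> \<open>The gap is cut down to half its size, away from the ends of the interval where the mass bound holds.\<close>
  define l r where "l = (- g (ln p) - g v2) / 2" and "r = (- g (ln p) - g v1) / 2"
  have g: "g v1 < g (ln p)" "g (ln p) < g v2" using mono[of v1 "ln p"] mono[of "ln p" v2] v by auto
  have "measure (distr \<rho> borel ln) {l<..r} = 0"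
  proof (rule null_interval_of_quadratic[where \<alpha> = "- g v2" and \<beta> = "- g v1" and K = K and ?e0.0 = "1 / 4"])
    fix m e :: real assume m: "- g v2 < m" "m < - g v1" and e: "0 < e" "e \<le> 1 / 4"
    have "\<exists>u\<ge>v1. u \<le> v2 \<and> g u = - m"
    proof (rule IVT')
      show "continuous_on {v1..v2} g"
      proof (intro continuous_at_imp_continuous_on ballI)
        fix x assume "x \<in> {v1..v2}"
        then have "u1 < x" "x < u2" using v by auto
        then obtain d where "(g has_real_derivative d) (at x)" by (rule g_deriv)
        then show "isCont g x" by (rule DERIV_isCont)
      qed
    qed (use m v in auto)
    then obtain u where "v1 \<le> u" "u \<le> v2" "g u = - m" by blast
    with K[of u e] e v show "measure (distr \<rho> borel ln) {m - e..m + e} \<le> K * e\<^sup>2" by simp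
  qed (use g M.finite_measure_axioms in \<open>auto simp: l_def r_def\<close>)
  then have "AE x in distr \<rho> borel ln. x \<notin> {l<..r}"
    by (subst AE_iff_measurable[of "{l<..r}"]) (auto simp: M.emeasure_eq_measure)
  then have "AE x in \<rho>. ln x \<notin> {l<..r}" by (subst (asm) AE_distr_iff) auto
  then have AE: "AE x in \<rho>. x \<le> exp l \<or> exp r \<le> x"
    using rho.pos
  proof eventually_elim
    case (elim x)
    then have "ln x \<le> l \<or> r \<le> ln x" by auto
    then show ?case using elim(2) by (metis exp_le_cancel_iff exp_ln)
  qed
  have lr: "exp l * q < 1" "1 < exp r * q"
  proof -
    have "l + g (ln p) < 0" "0 < r + g (ln p)" using g by (auto simp: l_def r_def field_simps)
    then show "exp l * q < 1" "1 < exp r * q" by (auto simp: q_def simp flip: exp_add)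
  qed
  have q_regular: "of_real q \<in> regular_points \<rho>" by (rule rho.regular_of_gap[OF q lr AE])
  have lim: "(\<lambda>n. exp (log_H (Complex (ln p) (1 / real (Suc n))))) \<longlonglongrightarrow> of_real q"
    using tendsto_exp[OF log_H_tendsto[OF u1 u2]] by (simp add: q_def exp_of_real)
  have "isCont (herglotz \<rho>) (of_real q)" by (rule DERIV_isCont[OF rho.has_field_derivative_herglotz[OF q_regular]])
  from isCont_tendsto_compose[OF this lim]
  have "(\<lambda>n. herglotz \<rho> (exp (log_H (Complex (ln p) (1 / real (Suc n)))))) \<longlonglongrightarrow> herglotz \<rho> (of_real q)" .
  moreover have "herglotz \<rho> (exp (log_H (Complex (ln p) (1 / real (Suc n))))) = herglotz \<nu> (exp (Complex (ln p) (1 / real (Suc n))))" for n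
    using approach_in_strip[OF u1 u2] by (intro herglotz_exp_log_H) auto
  ultimately have 1: "(\<lambda>n. herglotz \<nu> (exp (Complex (ln p) (1 / real (Suc n))))) \<longlonglongrightarrow> herglotz \<rho> (of_real q)" by simp
  have "(\<lambda>n. Complex (ln p) (1 / real (Suc n))) \<longlonglongrightarrow> Complex (ln p) 0"
    by (intro tendsto_Complex tendsto_const) real_asymp
  from tendsto_exp[OF this] have "(\<lambda>n. exp (Complex (ln p) (1 / real (Suc n)))) \<longlonglongrightarrow> of_real p"
    using p by (simp add: complex_of_real_def[symmetric] exp_of_real)
  moreover have "isCont (herglotz \<nu>) (of_real p)" by (rule DERIV_isCont[OF nu.has_field_derivative_herglotz[OF p_regular]])
  ultimately have "(\<lambda>n. herglotz \<nu> (exp (Complex (ln p) (1 / real (Suc n))))) \<longlonglongrightarrow> herglotz \<nu> (of_real p)"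
    by (intro isCont_tendsto_compose[of _ "herglotz \<nu>"])
  from LIMSEQ_unique[OF 1 this] show ?thesis
    using that[of q "exp l" "exp r"] q q_eq lr AE q_regular by simp
qed

end

lemma (in subordination_gap) gap:
  obtains q a b where "0 < q" "q = p * exp (- (t / 2 * Re (herglotz \<nu> (of_real p))))"
    "0 < a" "a * q < 1" "1 < b * q" "AE x in \<rho>. x \<le> a \<or> b \<le> x"
    "of_real q \<in> regular_points \<rho>" "herglotz \<rho> (of_real q) = herglotz \<nu> (of_real p)"
proof -
  obtain u1 u2 \<kappa> where "u1 < ln p" "ln p < u2" "0 < \<kappa>" "\<kappa> < 1"
    "\<And>u. u1 < u \<Longrightarrow> u < u2 \<Longrightarrow> of_real (exp u) \<in> regular_points \<nu>"
    "\<And>u. u1 < u \<Longrightarrow> u < u2 \<Longrightarrow> t * exp u * nu.poisson (of_real (exp u)) \<le> \<kappa>"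
    using subcritical_near_p by blast
  then interpret subordination_strip \<nu> \<rho> t p u1 u2 \<kappa> by unfold_locales
  show ?thesis by (rule gap_of_strip) (rule that)
qed

section \<open>Mass on both sides of the gap\<close>

text \<open>
  The situation to be refuted: \<open>\<rho>\<close> lives below its gap point \<open>1 / q\<close>.
\<close>

locale bounded_subordination = nu: pos_prob \<nu> + rho: pos_prob \<rho> for \<nu> \<rho> :: "real measure" +
  fixes t q :: real
  assumes sub: "subordinated t \<nu> \<rho>" and t: "0 < t" and q: "0 < q"
    and q_regular: "of_real q \<in> regular_points \<rho>"
    and bounded: "AE x in \<rho>. x * q < 1"
begin

text \<open>
  The left inverse of \<open>H\<close>: if \<open>z = H(w)\<close> then \<open>k\<^sub>\<nu>(w) = k\<^sub>\<rho>(z)\<close>, and hence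
  \<open>w = z exp (t k\<^sub>\<nu>(w) / 2) = G(z)\<close>.
\<close>

definition G :: "complex \<Rightarrow> complex" where
  "G z = z * exp (of_real (t / 2) * herglotz \<rho> z)"

text \<open>
  It suffices that \<open>H\<close> maps the negative half-axis onto itself. Since \<open>- 1 < k\<^sub>\<nu> < 1\<close> there, \<open>- H(- s)\<close> lies
  between \<open>s exp (- t / 2)\<close> and \<open>s exp (t / 2)\<close>, so the intermediate value theorem applies.
\<close>

lemma identity_on_negatives:
  assumes "0 < r"
  shows "herglotz \<nu> (G (- of_real r)) = herglotz \<rho> (- of_real r)"
proof -
  define h where "h s = s * exp (- (t / 2 * (2 * nu.resolvent_mean s - 1)))" for s
  have H: "- of_real s * exp (- (of_real (t / 2) * herglotz \<nu> (- of_real s))) = complex_of_real (- h s)"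
    if "0 < s" for s
    unfolding nu.herglotz_neg[OF that] h_def by (simp add: exp_of_real[symmetric])
  have e: "exp (- (t / 2)) < exp (- (t / 2 * (2 * nu.resolvent_mean s - 1)))"
    "exp (- (t / 2 * (2 * nu.resolvent_mean s - 1))) < exp (t / 2)" if "0 < s" for s
    using nu.resolvent_mean_bounds[OF that] t by (auto simp: field_simps)
  define s1 s2 where "s1 = r * exp (- (t / 2))" and "s2 = r * exp (t / 2)"
  have s: "0 < s1" "s1 \<le> s2" "0 < s2" using assms t by (auto simp: s1_def s2_def)
  have "h s1 \<le> s1 * exp (t / 2)" using e[OF s(1)] s by (simp add: h_def)
  also have "\<dots> = r" by (simp add: s1_def flip: exp_add)
  finally have 1: "h s1 \<le> r" .
  have "r = s2 * exp (- (t / 2))" by (simp add: s2_def flip: exp_add)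
  also have "\<dots> \<le> h s2" unfolding h_def by (intro mult_left_mono less_imp_le e s)
  finally have 2: "r \<le> h s2" .
  have "\<exists>s\<ge>s1. s \<le> s2 \<and> h s = r"
  proof (rule IVT'[OF 1 2 s(2)])
    show "continuous_on {s1..s2} h" unfolding h_def
      by (intro continuous_intros continuous_on_subset[OF nu.resolvent_mean_continuous]) (use s in auto)
  qed
  then obtain s where "s1 \<le> s" "h s = r" by blast
  with s(1) have s: "0 < s" "h s = r" by auto
  let ?w = "- complex_of_real s"
  have w: "?w \<in> neg_reals" using s by (auto simp: neg_reals_def intro!: image_eqI[of _ _ "- s"])
  have Hw: "?w * exp (- (of_real (t / 2) * herglotz \<nu> ?w)) = - of_real r" using H[OF s(1)] s(2) by simp
  then have eq: "herglotz \<rho> (- of_real r) = herglotz \<nu> ?w" using sub w unfolding subordinated_def by metis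
  have "G (- of_real r) = - of_real r * exp (of_real (t / 2) * herglotz \<nu> ?w)" by (simp only: G_def eq)
  also have "\<dots> = ?w" unfolding Hw[symmetric] mult.assoc exp_add[symmetric] by simp
  finally have "G (- of_real r) = ?w" .
  then show ?thesis using eq by simp
qed

lemma poisson_bounded_on_disc:
  obtains B where "0 < B" "\<And>z. cmod z \<le> q \<Longrightarrow> z \<in> regular_points \<rho> \<and> rho.poisson z \<le> B"
proof -
  obtain c where c: "c > 0" "AE x in \<rho>. 0 < x \<and> c * (1 + x) \<le> cmod (1 - of_real x * of_real q)"
    using q_regular by (rule rho.regular_pointsE)
  have "z \<in> regular_points \<rho> \<and> rho.poisson z \<le> 1 / c\<^sup>2" if z: "cmod z \<le> q" for z
  proof
    have AE: "AE x in \<rho>. 0 < x \<and> c * (1 + x) \<le> cmod (1 - of_real x * z)"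
      using c(2) bounded
    proof eventually_elim
      case (elim x)
      have "c * (1 + x) \<le> \<bar>1 - x * q\<bar>" using elim by (simp only: rho.cmod_one_minus)
      also have "\<dots> = 1 - x * q" using elim by simp
      also have "\<dots> \<le> 1 - x * cmod z" using elim z by (simp add: mult_left_mono)
      also have "\<dots> = cmod 1 - cmod (of_real x * z)" using elim by (simp add: norm_mult)
      also have "\<dots> \<le> cmod (1 - of_real x * z)" by (rule norm_triangle_ineq2)
      finally show ?case using elim by simp
    qed
    then show "z \<in> regular_points \<rho>" using c(1) unfolding regular_points_def by (auto elim: eventually_mono)
    have "norm (rho.poisson z) \<le> 1 / c\<^sup>2" unfolding rho.poisson_def
    proof (rule rho.norm_integral_le)
      show "AE x in \<rho>. norm (x / (cmod (1 - of_real x * z))\<^sup>2) \<le> 1 / c\<^sup>2"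
        using AE
      proof eventually_elim
        case (elim x)
        have "norm (x / (cmod (1 - of_real x * z))\<^sup>2) = x / (cmod (1 - of_real x * z))\<^sup>2" using elim by simp
        also have "\<dots> \<le> x / (c * (1 + x))\<^sup>2"
          using elim c(1) rho.regular_ne[of x c z] by (intro divide_left_mono power_mono mult_pos_pos zero_less_power) auto
        also have "\<dots> = 1 / c\<^sup>2 * (x / (1 + x)\<^sup>2)" by (simp add: power_mult_distrib)
        also have "\<dots> \<le> 1 / c\<^sup>2 * 1"
        proof (intro mult_left_mono)
          have "x \<le> (1 + x)\<^sup>2" using elim by (simp add: power2_eq_square algebra_simps)
          then show "x / (1 + x)\<^sup>2 \<le> 1" using elim by simp
        qed simp
        finally show ?case by simp
      qed
    qed measurable
    then show "rho.poisson z \<le> 1 / c\<^sup>2" by simp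
  qed
  then show ?thesis using that[of "1 / c\<^sup>2"] c(1) by simp
qed

lemma G_cnj: "G (cnj z) = cnj (G z)"
  by (simp add: G_def rho.herglotz_cnj exp_cnj)

lemma G_of_real: "G (of_real r) = of_real (r * exp (t / 2 * Re (herglotz \<rho> (of_real r))))"
  unfolding G_def rho.herglotz_of_real by (simp add: exp_of_real[symmetric])

text \<open>
  In the disc \<open>Im k\<^sub>\<rho>(z)\<close> is \<open>O(Im z)\<close>. So on a thin horizontal layer \<open>arg G\<close> exceeds \<open>arg z\<close> by less
  than \<open>\<pi>\<close>, and \<open>G\<close> avoids the slit.
\<close>

lemma G_notin_nonneg_Reals:
  assumes B: "0 < B" "\<And>z. cmod z \<le> q \<Longrightarrow> z \<in> regular_points \<rho> \<and> rho.poisson z \<le> B"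
    and z: "cmod z < q" "t * (\<bar>Im z\<bar> * B) < pi" "z \<notin> \<real>\<^sub>\<ge>\<^sub>0"
  shows "G z \<notin> \<real>\<^sub>\<ge>\<^sub>0"
proof -
  have upper: "G z \<notin> \<real>\<^sub>\<ge>\<^sub>0" if z: "cmod z < q" "t * (\<bar>Im z\<bar> * B) < pi" and "0 < Im z" for z
  proof -
    have z0: "z \<noteq> 0" using that by auto
    let ?\<zeta> = "Ln z + of_real (t / 2) * herglotz \<rho> z"
    have G: "G z = exp ?\<zeta>" using z0 by (simp add: G_def exp_add)
    have Ln: "0 < Im (Ln z)" "Im (Ln z) < pi" using Im_Ln_pos_lt[OF z0] that by auto
    have Bz: "z \<in> regular_points \<rho>" "rho.poisson z \<le> B" using B(2)[of z] z by auto
    have "Im (of_real (t / 2) * herglotz \<rho> z) = t * (Im z * rho.poisson z)"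
      by (simp add: rho.Im_herglotz[OF Bz(1)])
    moreover have "t * (Im z * rho.poisson z) \<le> t * (\<bar>Im z\<bar> * B)"
      using t Bz(2) that by (intro mult_left_mono) auto
    moreover have "0 \<le> t * (Im z * rho.poisson z)" using t that rho.poisson_nonneg by simp
    ultimately have "0 < Im ?\<zeta>" "Im ?\<zeta> < 2 * pi" using Ln z(2) by (auto simp del: Im_complex_of_real)
    then show ?thesis unfolding G by (rule exp_notin_nonneg_Reals)
  qed
  consider "0 < Im z" | "Im z < 0" | "Im z = 0" by linarith
  then show ?thesis
  proof cases
    case 1
    then show ?thesis using upper z by blast
  next
    case 2
    then have "G (cnj z) \<notin> \<real>\<^sub>\<ge>\<^sub>0" using z by (intro upper) auto
    then show ?thesis by (simp add: G_cnj complex_nonneg_Reals_iff)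
  next
    case 3
    then have "z = of_real (Re z)" "Re z < 0" using z(3) by (auto simp: complex_eq_iff complex_nonneg_Reals_iff)
    moreover from this(2) have "Re z * exp (t / 2 * Re (herglotz \<rho> (of_real (Re z)))) < 0" by (simp add: mult_neg_pos)
    ultimately show ?thesis using G_of_real[of "Re z"] by (simp add: complex_nonneg_Reals_iff)
  qed
qed

lemma G_holomorphic: "G holomorphic_on regular_points \<rho>"
  unfolding G_def by (intro holomorphic_intros rho.herglotz_holomorphic)

text \<open>
  A convex set minus the positive half-axis is starlike with respect to each of its negative points,
  and therefore connected. So the identity continues from the negative half-axis.
\<close>

lemma identity_near_disc:
  assumes B: "0 < B" "\<And>z. cmod z \<le> q \<Longrightarrow> z \<in> regular_points \<rho> \<and> rho.poisson z \<le> B"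
    and z: "cmod z < q" "t * (\<bar>Im z\<bar> * B) < pi" "z \<notin> \<real>\<^sub>\<ge>\<^sub>0"
  shows "herglotz \<nu> (G z) = herglotz \<rho> z"
proof -
  define b where "b = pi / (t * B)"
  have b: "0 < b" using B t by (simp add: b_def)
  have b_iff: "t * (\<bar>y\<bar> * B) < pi \<longleftrightarrow> \<bar>y\<bar> < b" for y using B t by (simp add: b_def field_simps)
  define C where "C = ball 0 q \<inter> {z. - b < Im z} \<inter> {z. Im z < b}"
  define \<Omega> where "\<Omega> = C - \<real>\<^sub>\<ge>\<^sub>0"
  let ?f = "\<lambda>z. herglotz \<nu> (G z) - herglotz \<rho> z"
  let ?U = "{z \<in> \<Omega>. Im z = 0}"
  have C: "convex C" "open C" unfolding C_def
    by (intro convex_Int convex_ball convex_halfspace_Im_gt convex_halfspace_Im_lt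
        open_Int open_ball open_halfspace_Im_gt open_halfspace_Im_lt)+
  have mem: "z \<in> \<Omega> \<longleftrightarrow> cmod z < q \<and> t * (\<bar>Im z\<bar> * B) < pi \<and> z \<notin> \<real>\<^sub>\<ge>\<^sub>0" for z
    unfolding b_iff by (auto simp: \<Omega>_def C_def abs_less_iff)
  have real: "- of_real s \<in> ?U" if "0 < s" "s < q" for s
    using that b by (auto simp: mem b_iff complex_nonneg_Reals_iff)
  have "?f z = 0"
  proof (rule analytic_continuation[of ?f \<Omega> ?U "- of_real (q / 2)"])
    have "z \<in> regular_points \<rho>" if "z \<in> \<Omega>" for z using that B(2)[of z] by (simp add: mem)
    moreover have "G z \<in> regular_points \<nu>" if "z \<in> \<Omega>" for z
      using that G_notin_nonneg_Reals[OF B] by (intro nu.regular_off_nonneg_Reals) (auto simp: mem)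
    ultimately show "?f holomorphic_on \<Omega>"
      by (intro holomorphic_intros holomorphic_on_compose_gen[OF _ nu.herglotz_holomorphic, unfolded o_def]
           holomorphic_on_subset[OF G_holomorphic] holomorphic_on_subset[OF rho.herglotz_holomorphic]) auto
    show "open \<Omega>" unfolding \<Omega>_def by (intro open_Diff C closed_nonneg_Reals_complex)
    have "starlike \<Omega>" unfolding starlike_def
    proof (intro bexI ballI subsetI)
      show a: "- of_real (q / 2) \<in> \<Omega>" using real[of "q / 2"] q by simp
      fix x y assume x: "x \<in> \<Omega>" and "y \<in> closed_segment (- of_real (q / 2)) x"
      then obtain u where u: "0 \<le> u" "u \<le> 1" and y: "y = (1 - u) *\<^sub>R (- of_real (q / 2)) + u *\<^sub>R x"
        by (auto simp: closed_segment_def)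
      have "y \<in> C" using \<open>y \<in> closed_segment (- of_real (q / 2)) x\<close> closed_segment_subset[OF _ _ C(1)] a x
        by (auto simp: \<Omega>_def)
      moreover have "y \<notin> \<real>\<^sub>\<ge>\<^sub>0"
      proof (cases "u = 0")
        case True
        then show ?thesis using q by (simp add: y complex_nonneg_Reals_iff)
      next
        case False
        show ?thesis
        proof
          assume "y \<in> \<real>\<^sub>\<ge>\<^sub>0"
          then have "0 \<le> Re y" "u * Im x = 0" by (auto simp: complex_nonneg_Reals_iff y)
          then have "Re x < 0" using x False by (auto simp: \<Omega>_def complex_nonneg_Reals_iff)
          then have "u * Re x < 0" using u False by (simp add: mult_pos_neg)
          moreover have "0 \<le> (1 - u) * (q / 2)" using u q by simp
          ultimately have "Re y < 0" by (simp add: y)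
          with \<open>0 \<le> Re y\<close> show False by simp
        qed
      qed
      ultimately show "y \<in> \<Omega>" by (simp add: \<Omega>_def)
    qed
    then show "connected \<Omega>" by (rule starlike_imp_connected)
    show "- of_real (q / 2) \<in> \<Omega>" using real[of "q / 2"] q by simp
    show "- of_real (q / 2) islimpt ?U" unfolding islimpt_approachable
    proof (intro allI impI)
      fix e :: real assume e: "0 < e"
      define h where "h = min (e / 2) (q / 4)"
      have h: "0 < h" "h < e" "h < q / 2" using e q by (auto simp: h_def min_def)
      have "- of_real (q / 2 + h) \<in> ?U" using h q by (intro real) auto
      moreover have "- of_real (q / 2 + h) \<noteq> - complex_of_real (q / 2)" using h(1) by (simp del: of_real_add of_real_divide)
      moreover have "dist (- of_real (q / 2 + h)) (- complex_of_real (q / 2)) < e" using h by (simp add: dist_norm)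
      ultimately show "\<exists>x'\<in>?U. x' \<noteq> - of_real (q / 2) \<and> dist x' (- of_real (q / 2)) < e" by blast
    qed
    fix z assume "z \<in> ?U"
    then have "z = - of_real (- Re z)" "0 < - Re z" by (auto simp: complex_eq_iff \<Omega>_def complex_nonneg_Reals_iff)
    then show "?f z = 0" using identity_on_negatives by (metis right_minus_eq)
  qed (use z in \<open>auto simp: mem\<close>)
  then show ?thesis by simp
qed

text \<open>
  By the intermediate value theorem some \<open>r\<close> in \<open>(0, q)\<close> has \<open>G(r) = 1 / a\<close>, and \<open>G'(r) > 0\<close>. Let
  \<open>w = G(r + \<i> e)\<close>. Then \<open>Im k\<^sub>\<nu>(w) = Im k\<^sub>\<rho>(r + \<i> e) = O(e)\<close>, whereas an atom at \<open>a\<close> makes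
  \<open>Im k\<^sub>\<nu>(w)\<close> at least a multiple of \<open>Im w / |1 - a w|\<^sup>2\<close>, which is of order \<open>1 / e\<close>.
\<close>

lemma no_atom_above:
  assumes a: "0 < a" "1 < a * (q * exp (t / 2 * Re (herglotz \<rho> (of_real q))))"
  shows "measure \<nu> {a} = 0"
proof (rule ccontr)
  assume "measure \<nu> {a} \<noteq> 0"
  then have m: "0 < measure \<nu> {a}" using zero_less_measure_iff by blast
  obtain B where B: "0 < B" "\<And>z. cmod z \<le> q \<Longrightarrow> z \<in> regular_points \<rho> \<and> rho.poisson z \<le> B"
    using poisson_bounded_on_disc by blast
  define \<gamma> where "\<gamma> r = r * exp (t / 2 * Re (herglotz \<rho> (of_real r)))" for r
  have cont: "continuous_on {0..q} \<gamma>"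
    unfolding \<gamma>_def
    by (intro continuous_intros continuous_on_compose2[OF holomorphic_on_imp_continuous_on[OF rho.herglotz_holomorphic]])
      (use B in auto)
  have "\<exists>r\<ge>0. r \<le> q \<and> \<gamma> r = 1 / a"
    by (rule IVT'[OF _ _ _ cont]) (use a q in \<open>auto simp: \<gamma>_def field_simps\<close>)
  then obtain r where r: "0 \<le> r" "r \<le> q" "\<gamma> r = 1 / a" by blast
  have "r \<noteq> 0" using r(3) a(1) by (auto simp: \<gamma>_def)
  moreover have "r \<noteq> q" using r(3) a by (auto simp: \<gamma>_def)
  ultimately have r': "0 < r" "r < q" using r by auto
  let ?r = "complex_of_real r"
  have Gr: "G ?r = of_real (1 / a)" unfolding G_of_real using r(3) by (simp add: \<gamma>_def)
  have r_reg: "?r \<in> regular_points \<rho>" using B(2)[of ?r] r by simp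
  define E d where "E = exp (t / 2 * Re (herglotz \<rho> ?r))" and "d = E + t * (r * rho.poisson ?r) * E"
  have d: "0 < d" using t r rho.poisson_nonneg by (auto simp: d_def E_def intro!: add_pos_nonneg)
  have "herglotz \<rho> ?r = of_real (Re (herglotz \<rho> ?r))" unfolding rho.herglotz_of_real by simp
  then have E: "exp (of_real (t / 2) * herglotz \<rho> ?r) = of_real E"
    unfolding E_def exp_of_real[symmetric] by (metis of_real_mult)
  have "(G has_field_derivative 1 * exp (of_real (t / 2) * herglotz \<rho> ?r)
     + (exp (of_real (t / 2) * herglotz \<rho> ?r) * (of_real (t / 2) * of_real (2 * rho.poisson ?r))) * ?r) (at ?r)"
    unfolding G_def
    by (intro DERIV_mult DERIV_ident DERIV_fun_exp DERIV_cmult rho.herglotz_deriv_real r_reg)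
  then have dG: "(G has_field_derivative of_real d) (at ?r)"
    unfolding E by (simp add: d_def mult_ac)
  define e where "e n = 1 / real (Suc n)" for n
  have e: "e \<longlonglongrightarrow> 0" "0 < e n" for n unfolding e_def by real_asymp simp
  define z where "z n = Complex r (e n)" for n
  define w where "w n = G (z n)" for n
  have z_diff: "z n - ?r = \<i> * of_real (e n)" for n by (simp add: z_def complex_eq_iff)
  have z_ne: "z n \<noteq> ?r" for n
  proof -
    have "z n - ?r \<noteq> 0" unfolding z_diff using e(2)[of n] by simp
    then show ?thesis by simp
  qed
  have zlim: "z \<longlonglongrightarrow> ?r" unfolding z_def complex_of_real_def by (intro tendsto_Complex tendsto_const e)
  have "(\<lambda>n. (G (z n) - G ?r) / (z n - ?r)) \<longlonglongrightarrow> of_real d"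
    using dG[unfolded has_field_derivative_iff]
    by (rule filterlim_compose[of "\<lambda>y. (G y - G ?r) / (y - ?r)"])
      (use zlim z_ne in \<open>auto simp: filterlim_at intro!: always_eventually\<close>)
  then have lim: "(\<lambda>n. (w n - of_real (1 / a)) / (\<i> * of_real (e n))) \<longlonglongrightarrow> of_real d"
    unfolding z_diff Gr w_def .
  have "(\<lambda>n. Re ((w n - of_real (1 / a)) / (\<i> * of_real (e n)))) \<longlonglongrightarrow> d"
    using tendsto_Re[OF lim] by simp
  moreover have "Re ((w n - of_real (1 / a)) / (\<i> * of_real (e n))) = Im (w n) / e n" for n
    using e(2)[of n] by (simp add: Re_divide power2_eq_square)
  ultimately have lim1: "(\<lambda>n. Im (w n) / e n) \<longlonglongrightarrow> d" by simp
  have "(\<lambda>n. cmod ((w n - of_real (1 / a)) / (\<i> * of_real (e n)))) \<longlonglongrightarrow> \<bar>d\<bar>"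
    using tendsto_norm[OF lim] by simp
  moreover have "cmod ((w n - of_real (1 / a)) / (\<i> * of_real (e n))) = cmod (w n - of_real (1 / a)) / e n" for n
    using e(2)[of n] by (simp add: norm_divide norm_mult)
  ultimately have lim2: "(\<lambda>n. cmod (w n - of_real (1 / a)) / e n) \<longlonglongrightarrow> \<bar>d\<bar>" by simp
  have ev1: "\<forall>\<^sub>F n in sequentially. cmod (z n) < q"
    using tendsto_norm[OF zlim] r' by (intro order_tendstoD(2)[of _ r]) auto
  have "(\<lambda>n. t * (\<bar>e n\<bar> * B)) \<longlonglongrightarrow> t * (\<bar>0\<bar> * B)" by (intro tendsto_intros e)
  then have ev2: "\<forall>\<^sub>F n in sequentially. t * (\<bar>e n\<bar> * B) < pi"
    by (rule order_tendstoD(2)) simp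
  have "\<forall>\<^sub>F n in sequentially. measure \<nu> {a} * (Im (w n) / e n)
      \<le> B * a * (e n)\<^sup>2 * (cmod (w n - of_real (1 / a)) / e n)\<^sup>2"
    using ev1 ev2
  proof eventually_elim
    case (elim n)
    have zn: "cmod (z n) < q" "t * (\<bar>Im (z n)\<bar> * B) < pi" "z n \<notin> \<real>\<^sub>\<ge>\<^sub>0"
      using elim e(2)[of n] by (auto simp: z_def complex_nonneg_Reals_iff)
    have w: "w n \<notin> \<real>\<^sub>\<ge>\<^sub>0" unfolding w_def by (rule G_notin_nonneg_Reals[OF B zn])
    then have w_reg: "w n \<in> regular_points \<nu>" by (rule nu.regular_off_nonneg_Reals)
    have zn_reg: "z n \<in> regular_points \<rho>" "rho.poisson (z n) \<le> B" using B(2)[of "z n"] zn by auto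
    have "herglotz \<nu> (w n) = herglotz \<rho> (z n)" unfolding w_def by (rule identity_near_disc[OF B zn])
    then have "2 * Im (w n) * nu.poisson (w n) = 2 * Im (z n) * rho.poisson (z n)"
      using nu.Im_herglotz[OF w_reg] rho.Im_herglotz[OF zn_reg(1)] by simp
    then have 1: "Im (w n) * nu.poisson (w n) \<le> e n * B"
      using zn_reg(2) e(2)[of n] by (simp add: z_def mult_left_mono)
    let ?D = "cmod (1 - of_real a * w n)"
    have "1 - of_real a * w n = - of_real a * (w n - of_real (1 / a))" using a(1) by (simp add: algebra_simps)
    then have D: "?D = a * cmod (w n - of_real (1 / a))" using a(1) by (simp add: norm_mult)
    have "w n \<noteq> of_real (1 / a)" using w a(1) by (auto simp: complex_nonneg_Reals_iff)
    then have Dpos: "0 < ?D" using D a(1) by simp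
    have "Im (w n) * (measure \<nu> {a} * (a / ?D\<^sup>2)) \<le> e n * B"
    proof (cases "0 \<le> Im (w n)")
      case True
      then show ?thesis using mult_left_mono[OF nu.poisson_atom[OF w_reg a(1)]] 1 by (meson order_trans)
    next
      case False
      then have "Im (w n) * (measure \<nu> {a} * (a / ?D\<^sup>2)) \<le> 0" using a(1) by (intro mult_nonpos_nonneg) auto
      also have "0 \<le> e n * B" using B(1) e(2)[of n] by simp
      finally show ?thesis .
    qed
    then have "measure \<nu> {a} * Im (w n) * a \<le> e n * B * ?D\<^sup>2" using Dpos by (simp add: field_simps)
    also have "\<dots> = (e n * B * a * (cmod (w n - of_real (1 / a)))\<^sup>2) * a" by (simp add: D power2_eq_square)
    finally have "measure \<nu> {a} * Im (w n) \<le> e n * B * a * (cmod (w n - of_real (1 / a)))\<^sup>2"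
      using a(1) by (simp only: mult_le_cancel_right_pos)
    then have "measure \<nu> {a} * Im (w n) / e n \<le> e n * B * a * (cmod (w n - of_real (1 / a)))\<^sup>2 / e n"
      using e(2)[of n] by (intro divide_right_mono) auto
    then show ?case using e(2)[of n] by (simp add: power_divide)
  qed
  moreover have "(\<lambda>n. measure \<nu> {a} * (Im (w n) / e n)) \<longlonglongrightarrow> measure \<nu> {a} * d"
    by (intro tendsto_intros lim1)
  moreover have "(\<lambda>n. B * a * (e n)\<^sup>2 * (cmod (w n - of_real (1 / a)) / e n)\<^sup>2) \<longlonglongrightarrow> B * a * 0\<^sup>2 * \<bar>d\<bar>\<^sup>2"
    by (intro tendsto_intros lim2 e)
  ultimately have "measure \<nu> {a} * d \<le> B * a * 0\<^sup>2 * \<bar>d\<bar>\<^sup>2"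
    by (intro tendsto_le[OF sequentially_bot])
  moreover have "0 < measure \<nu> {a} * d" using m d by simp
  ultimately show False by simp
qed

end

section \<open>Log-unimodality excludes gaps\<close>

text \<open>
  The mode is on one side of the midpoint of the gap. On the other half of the gap the density is
  monotone with integral \<open>0\<close>, so it vanishes there and from there on outwards.
\<close>

lemma unimodal_gap:
  assumes "unimodal_with_mode M m" "l < r" "emeasure M {l<..<r} = 0"
  shows "emeasure M {..l} = 0 \<or> emeasure M {r..} = 0"
proof -
  obtain c f where f: "\<And>x. 0 \<le> f x" "mono_on {..<m} f" "antimono_on {m<..} f"
    and M: "\<And>A. A \<in> sets borel \<Longrightarrow> emeasure M A = c * indicator A m + (\<integral>\<^sup>+x\<in>A. ennreal (f x) \<partial>lborel)"
    using assms(1) unfolding unimodal_with_mode_def by blast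
  have gap: "(\<integral>\<^sup>+x\<in>{l<..<r}. ennreal (f x) \<partial>lborel) = 0" using M[of "{l<..<r}"] assms(3) by simp
  \<comment> \<open>The density is not assumed to be measurable, so its integral is compared with that of a constant minorant.\<close>
  have zero: "v = 0" if "l \<le> a" "a < b" "b \<le> r" "0 \<le> v" "\<And>x. a < x \<Longrightarrow> x < b \<Longrightarrow> v \<le> f x" for a b v
  proof -
    have "(\<integral>\<^sup>+x. ennreal v * indicator {a<..<b} x \<partial>lborel) \<le> (\<integral>\<^sup>+x\<in>{l<..<r}. ennreal (f x) \<partial>lborel)"
      by (rule nn_integral_mono) (use that in \<open>auto simp: indicator_def intro!: ennreal_leI\<close>)
    then have "ennreal v * ennreal (b - a) = 0" using gap that by (simp add: nn_integral_cmult_indicator)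
    then have "v * (b - a) \<le> 0" using that by (simp add: ennreal_eq_0_iff flip: ennreal_mult)
    then show ?thesis using that by (simp add: mult_le_0_iff)
  qed
  show ?thesis
  proof (cases "m \<le> (l + r) / 2")
    case True
    define y where "y = (l + 3 * r) / 4"
    have y: "(l + r) / 2 < y" "y < r" using assms(2) by (auto simp: y_def)
    have "f y = 0"
    proof (rule zero[of "(l + r) / 2" y])
      show "f y \<le> f x" if "(l + r) / 2 < x" "x < y" for x
        using monotone_onD[OF f(3), of x y] that True y by simp
    qed (use y assms(2) f in auto)
    then have 0: "f x = 0" if "r \<le> x" for x
      using monotone_onD[OF f(3), of y x] that True y f(1)[of x] by simp
    have "emeasure M {r..} = c * indicator {r..} m + (\<integral>\<^sup>+x\<in>{r..}. ennreal (f x) \<partial>lborel)" by (rule M) simp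
    also have "(\<integral>\<^sup>+x\<in>{r..}. ennreal (f x) \<partial>lborel) = (\<integral>\<^sup>+(x::real). 0 \<partial>lborel)"
      by (rule nn_integral_cong) (auto simp: indicator_def 0)
    finally show ?thesis using True y by simp
  next
    case False
    define y where "y = (3 * l + r) / 4"
    have y: "l < y" "y < (l + r) / 2" using assms(2) by (auto simp: y_def)
    have "f y = 0"
    proof (rule zero[of y "(l + r) / 2"])
      show "f y \<le> f x" if "y < x" "x < (l + r) / 2" for x
        using monotone_onD[OF f(2), of y x] that False y by simp
    qed (use y assms(2) f in auto)
    then have 0: "f x = 0" if "x \<le> l" for x
      using monotone_onD[OF f(2), of x y] that False y f(1)[of x] by simp
    have "emeasure M {..l} = c * indicator {..l} m + (\<integral>\<^sup>+x\<in>{..l}. ennreal (f x) \<partial>lborel)" by (rule M) simp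
    also have "(\<integral>\<^sup>+x\<in>{..l}. ennreal (f x) \<partial>lborel) = (\<integral>\<^sup>+(x::real). 0 \<partial>lborel)"
      by (rule nn_integral_cong) (auto simp: indicator_def 0)
    finally show ?thesis using False y by simp
  qed
qed

lemma (in pos_prob) log_unimodal_gap:
  assumes "log_unimodal \<mu>" "0 < a" "a < b" "AE x in \<mu>. x \<le> a \<or> b \<le> x"
  shows "(AE x in \<mu>. b \<le> x) \<or> (AE x in \<mu>. x \<le> a)"
proof -
  let ?M = "distr \<mu> borel ln"
  obtain m where uni: "unimodal_with_mode ?M m"
    using assms(1) by (auto simp: log_unimodal_def log_unimodal_with_mode_def)
  have null: "emeasure ?M A = 0 \<longleftrightarrow> (AE x in \<mu>. ln x \<notin> A)" if "A \<in> sets borel" for A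
  proof -
    have "emeasure ?M A = 0 \<longleftrightarrow> (AE x in ?M. x \<notin> A)"
      using that by (subst AE_iff_measurable[of A]) auto
    also have "\<dots> \<longleftrightarrow> (AE x in \<mu>. ln x \<notin> A)" using that by (subst AE_distr_iff) auto
    finally show ?thesis .
  qed
  have "emeasure ?M {ln a<..<ln b} = 0"
  proof (subst null)
    show "AE x in \<mu>. ln x \<notin> {ln a<..<ln b}"
      using pos assms(4) by eventually_elim (use assms(2,3) in auto)
  qed simp
  then have "emeasure ?M {..ln a} = 0 \<or> emeasure ?M {ln b..} = 0"
    using unimodal_gap[OF uni] assms(2,3) by simp
  then show ?thesis
  proof
    assume "emeasure ?M {..ln a} = 0"
    then have "AE x in \<mu>. ln x \<notin> {..ln a}" by (subst (asm) null) auto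
    with pos assms(4) have "AE x in \<mu>. b \<le> x"
      by eventually_elim (use assms(2) in auto)
    then show ?thesis ..
  next
    assume "emeasure ?M {ln b..} = 0"
    then have "AE x in \<mu>. ln x \<notin> {ln b..}" by (subst (asm) null) auto
    with pos assms(4) have "AE x in \<mu>. x \<le> a"
      by eventually_elim (use assms(2,3) in auto)
    then show ?thesis ..
  qed
qed

text \<open>
  If \<open>\<rho>\<close> were log-unimodal, it would live on one side of its gap. Below the gap, this contradicts
  the atom of \<open>\<nu>\<close> above \<open>1 / p\<close>; above the gap, inversion gives the same situation with the atom
  below \<open>1 / p\<close>.
\<close>

lemma not_log_unimodal_if_split:
  assumes "pos_prob \<nu>" "pos_prob \<rho>" and sub: "subordinated t \<nu> \<rho>" and t: "0 < t" and p: "0 < p"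
    and p_regular: "of_real p \<in> regular_points \<nu>"
    and p_small: "t * p * pos_prob.poisson \<nu> (of_real p) < 1"
    and a: "0 < a" "a * p < 1" "measure \<nu> {a} \<noteq> 0"
    and b: "1 < b * p" "measure \<nu> {b} \<noteq> 0"
  shows "\<not> log_unimodal \<rho>"
proof
  assume uni: "log_unimodal \<rho>"
  interpret nu: pos_prob \<nu> by fact
  interpret rho: pos_prob \<rho> by fact
  interpret subordination_gap \<nu> \<rho> t p by unfold_locales fact+
  obtain q l r where q: "0 < q" "q = p * exp (- (t / 2 * Re (herglotz \<nu> (of_real p))))"
    and gap: "0 < l" "l * q < 1" "1 < r * q" "AE x in \<rho>. x \<le> l \<or> r \<le> x"
    and q_reg: "of_real q \<in> regular_points \<rho>" "herglotz \<rho> (of_real q) = herglotz \<nu> (of_real p)"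
    by (rule gap)
  have p_eq: "p = q * exp (t / 2 * Re (herglotz \<rho> (of_real q)))"
    unfolding q_reg(2) by (subst q(2)) (simp add: exp_minus)
  have "l * q < r * q" using gap by linarith
  then have lr: "l < r" using q(1) by simp
  from rho.log_unimodal_gap[OF uni gap(1) lr gap(4)] show False
  proof
    assume "AE x in \<rho>. x \<le> l"
    then have bd: "AE x in \<rho>. x * q < 1"
    proof eventually_elim
      case (elim x)
      then have "x * q \<le> l * q" using q(1) by simp
      then show ?case using gap(2) by linarith
    qed
    interpret bounded_subordination \<nu> \<rho> t q
      by unfold_locales (fact sub t q q_reg bd)+
    have "0 < b" using b(1) p by (metis less_trans zero_less_one zero_less_mult_pos2)
    then have "measure \<nu> {b} = 0" using b(1) p_eq by (intro no_atom_above) simp_all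
    with b(2) show False by simp
  next
    assume "AE x in \<rho>. r \<le> x"
    then have bd: "AE x in \<rho>. 1 < x * q"
    proof eventually_elim
      case (elim x)
      then have "r * q \<le> x * q" using q(1) by simp
      then show ?case using gap(3) by linarith
    qed
    interpret inv: bounded_subordination "inv_measure \<nu>" "inv_measure \<rho>" t "1 / q"
    proof (intro bounded_subordination.intro bounded_subordination_axioms.intro)
      show "pos_prob (inv_measure \<nu>)" by (rule nu.pos_prob_inv)
      show "pos_prob (inv_measure \<rho>)" by (rule rho.pos_prob_inv)
      show "subordinated t (inv_measure \<nu>) (inv_measure \<rho>)" by (rule subordinated_inv) fact+
      show "0 < t" "0 < 1 / q" using t q by auto
      show "of_real (1 / q) \<in> regular_points (inv_measure \<rho>)" using rho.regular_inv[OF q_reg(1)] q(1) by simp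
      show "AE x in inv_measure \<rho>. x * (1 / q) < 1"
        using bd rho.pos q(1) by (subst AE_distr_iff) (auto elim!: eventually_elim2 simp: field_simps)
    qed
    have herg: "herglotz (inv_measure \<rho>) (of_real (1 / q)) = - herglotz \<rho> (of_real q)"
      using rho.herglotz_inv[of "of_real q"] q(1) by simp
    have "1 / a * (1 / q * exp (t / 2 * Re (herglotz (inv_measure \<rho>) (of_real (1 / q))))) = 1 / (a * p)"
      unfolding herg by (subst p_eq) (simp add: exp_minus field_simps)
    also have "1 < 1 / (a * p)" using a p by simp
    finally have "measure (inv_measure \<nu>) {1 / a} = 0" using a(1) by (intro inv.no_atom_above) auto
    then show False using a(3) nu.measure_inv_atom[OF a(1)] by simp
  qed
qed

section \<open>Atomic measures with accumulating gaps\<close>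

lemma atomic_measure_AE:
  assumes "Measurable.pred borel P" "\<And>n. P (a n)"
  shows "AE x in atomic_measure w a. P x"
  unfolding atomic_measure_def using assms by (subst AE_distr_iff) auto

lemma prob_space_atomic_measure:
  assumes "\<And>n. 0 < w n" "w sums 1"
  shows "prob_space (atomic_measure w a)"
proof
  have "emeasure (atomic_measure w a) (space (atomic_measure w a)) = (\<Sum>n. ennreal (w n))"
    using emeasure_atomic_measure[of UNIV w a] by (simp add: sets_eq_imp_space_eq[OF sets_atomic_measure])
  also have "\<dots> = ennreal (\<Sum>n. w n)"
    using assms less_imp_le by (intro suminf_ennreal2) (auto simp: sums_iff)
  finally show "emeasure (atomic_measure w a) (space (atomic_measure w a)) = 1"
    using assms(2) by (simp add: sums_iff)
qed

lemma pos_prob_atomic_measure: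
  assumes "\<And>n. 0 < w n" "w sums 1" "\<And>n. 0 < a n"
  shows "pos_prob (atomic_measure w a)"
  using prob_space_atomic_measure[OF assms(1,2), of a] atomic_measure_AE[of "\<lambda>x. 0 < x" a w] assms(3)
  by (simp add: pos_prob_def pos_prob_axioms_def)

lemma measure_atom_atomic_measure:
  assumes "\<And>n. 0 < w n" "w sums 1"
  shows "measure (atomic_measure w a) {a k} \<noteq> 0"
proof
  interpret prob_space "atomic_measure w a" by (rule prob_space_atomic_measure[OF assms])
  assume "measure (atomic_measure w a) {a k} = 0"
  then have "(\<Sum>n. ennreal (w n) * indicator {a k} (a n)) = 0"
    by (simp add: emeasure_eq_measure flip: emeasure_atomic_measure)
  then have "\<forall>n. ennreal (w n) * indicator {a k} (a n) = 0"
    using suminf_eq_zero_iff[of "\<lambda>n. ennreal (w n) * indicator {a k} (a n)"] by simp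
  then have "ennreal (w k) * indicator {a k} (a k) = 0" by blast
  then show False using assms(1)[of k] by simp
qed

lemma integral_atomic_measure_le:
  assumes "\<And>n. 0 < w n" "f \<in> borel_measurable borel" "\<And>n. 0 \<le> f (a n)"
    and "\<And>n. f (a n) \<le> C * v n" and "summable (\<lambda>n. w n * v n)"
  shows "(\<integral>x. f x \<partial>atomic_measure w a) \<le> C * (\<Sum>n. w n * v n)"
proof -
  have nn: "0 \<le> w n * (C * v n)" for n
    using assms(1)[of n] order_trans[OF assms(3)[of n] assms(4)[of n]] by simp
  have sm: "summable (\<lambda>n. w n * (C * v n))" using summable_mult[OF assms(5), of C] by (simp add: mult_ac)
  have eq: "(\<Sum>n. w n * (C * v n)) = C * (\<Sum>n. w n * v n)" using suminf_mult[OF assms(5), of C] by (simp add: mult_ac)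
  have "(\<integral>\<^sup>+x. ennreal (f x) \<partial>atomic_measure w a) = (\<integral>\<^sup>+n. ennreal (w n) * ennreal (f (a n)) \<partial>count_space UNIV)"
    unfolding atomic_measure_def using assms(2) by (simp add: nn_integral_distr nn_integral_density)
  also have "\<dots> = (\<Sum>n. ennreal (w n) * ennreal (f (a n)))" by (simp add: nn_integral_count_space_nat)
  also have "\<dots> \<le> (\<Sum>n. ennreal (w n * (C * v n)))"
  proof (rule suminf_le)
    show "ennreal (w n) * ennreal (f (a n)) \<le> ennreal (w n * (C * v n))" for n
      using assms(1)[of n] assms(3,4)[of n] by (subst ennreal_mult[symmetric]) (auto intro!: ennreal_leI mult_left_mono)
  qed auto
  also have "\<dots> = ennreal (C * (\<Sum>n. w n * v n))"
    using suminf_ennreal2[OF nn sm] by (simp add: eq)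
  finally have le: "(\<integral>\<^sup>+x. ennreal (f x) \<partial>atomic_measure w a) \<le> ennreal (C * (\<Sum>n. w n * v n))" .
  have "(\<integral>x. f x \<partial>atomic_measure w a) = enn2real (\<integral>\<^sup>+x. ennreal (f x) \<partial>atomic_measure w a)"
  proof (rule integral_eq_nn_integral)
    show "f \<in> borel_measurable (atomic_measure w a)"
      using assms(2) by (simp cong: measurable_cong_sets)
    show "AE x in atomic_measure w a. 0 \<le> f x" using assms(2,3) by (intro atomic_measure_AE) auto
  qed
  also have "\<dots> \<le> C * (\<Sum>n. w n * v n)"
    using le suminf_nonneg[OF sm nn] by (intro enn2real_leI) (auto simp: eq)
  finally show ?thesis .
qed

text \<open>
  The reciprocal \<open>p\<close> of the harmonic mean is the midpoint of \<open>[1 / \<alpha>, 1 / \<beta>]\<close>, and on the scale \<open>y = 1 / x\<close> the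
  integrand becomes \<open>p y / (y - p)\<^sup>2\<close>. For \<open>y\<close> outside the interval, \<open>|y - p|\<close> is at least half its length.
\<close>

lemma harmonic_mean_bound:
  fixes \<alpha> \<beta> x :: real
  assumes "0 < \<beta>" "\<beta> < \<alpha>" "0 < x" "x \<le> \<beta> \<or> \<alpha> \<le> x"
  defines "p \<equiv> (1 / \<alpha> + 1 / \<beta>) / 2"
  shows "x * p / (1 - x * p)\<^sup>2 \<le> 2 * (\<alpha> * \<beta> * (\<alpha> + \<beta>) / (\<alpha> - \<beta>)\<^sup>2) * inverse x"
proof -
  have p: "0 < p" using assms by (simp add: p_def add_pos_pos)
  define \<delta> where "\<delta> = (1 / \<beta> - 1 / \<alpha>) / 2"
  have \<delta>: "0 < \<delta>" using assms by (simp add: \<delta>_def divide_strict_left_mono)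
  have "\<delta> \<le> \<bar>1 / x - p\<bar>"
    using assms(4)
  proof
    assume "x \<le> \<beta>"
    then have "1 / \<beta> \<le> 1 / x" using assms by (intro divide_left_mono) auto
    moreover have "1 / \<beta> - p = \<delta>" by (simp add: p_def \<delta>_def field_simps)
    ultimately show ?thesis by linarith
  next
    assume "\<alpha> \<le> x"
    then have "1 / x \<le> 1 / \<alpha>" using assms by (intro divide_left_mono) auto
    moreover have "p - 1 / \<alpha> = \<delta>" by (simp add: p_def \<delta>_def field_simps)
    ultimately show ?thesis by linarith
  qed
  then have sq: "\<delta>\<^sup>2 \<le> (1 / x - p)\<^sup>2" using \<delta> by (metis abs_le_square_iff abs_of_pos)
  have "(1 - x * p)\<^sup>2 = x\<^sup>2 * (1 / x - p)\<^sup>2" using assms(3) by (simp add: power_mult_distrib[symmetric] right_diff_distrib)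
  then have "x * p / (1 - x * p)\<^sup>2 = p * inverse x / (1 / x - p)\<^sup>2"
    using assms(3) by (simp add: power2_eq_square field_simps)
  also have "\<dots> \<le> p * inverse x / \<delta>\<^sup>2"
    using sq p \<delta> assms(3) by (intro divide_left_mono) (auto intro!: mult_pos_pos less_le_trans[OF _ sq])
  also have "\<dots> = p / \<delta>\<^sup>2 * inverse x" by simp
  also have "p / \<delta>\<^sup>2 = 2 * (\<alpha> * \<beta> * (\<alpha> + \<beta>) / (\<alpha> - \<beta>)\<^sup>2)"
  proof -
    have "p = (\<alpha> + \<beta>) / (2 * \<alpha> * \<beta>)" "\<delta> = (\<alpha> - \<beta>) / (2 * \<alpha> * \<beta>)"
      using assms by (simp_all add: p_def \<delta>_def field_simps)
    then show ?thesis using assms by (simp add: power2_eq_square)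
  qed
  finally show ?thesis .
qed

theorem theorem4p5:
  fixes w a :: "nat \<Rightarrow> real" and t :: real and \<nu> \<sigma> :: "real measure"
  assumes w_pos: "\<And>n. 0 < w n"
    and a_pos: "\<And>n. 0 < a n"
    and a_decr: "\<And>n. a (Suc n) < a n"
    and a_lim: "a \<longlonglongrightarrow> 0"
    and gap_lim: "(\<lambda>k. a k * a (Suc k) * (a k + a (Suc k)) / (a k - a (Suc k))\<^sup>2) \<longlonglongrightarrow> 0"
    and w_sum: "w sums 1"
    and w_inv_sum: "summable (\<lambda>n. w n * inverse (a n))"
    and \<nu>_def: "\<nu> = atomic_measure w a"
    and t_pos: "0 < t"
    and \<sigma>: "is_free_mult_BM t \<sigma>"
  shows "(\<forall>\<rho>. is_free_mult_conv \<sigma> \<nu> \<rho> \<longrightarrow> \<not> log_unimodal \<rho>) \<and>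
         (\<forall>\<rho>. is_free_mult_conv \<sigma> (distr \<nu> borel (\<lambda>x. 1 / x)) \<rho> \<longrightarrow> \<not> log_unimodal \<rho>)"
proof -
  interpret nu: pos_prob \<nu> unfolding \<nu>_def by (rule pos_prob_atomic_measure[OF w_pos w_sum a_pos])
  define s where "s = (\<Sum>n. w n * inverse (a n))"
  define gap where "gap k = a k * a (Suc k) * (a k + a (Suc k)) / (a k - a (Suc k))\<^sup>2" for k
  have "(\<lambda>k. t * (2 * gap k * s)) \<longlonglongrightarrow> t * (2 * 0 * s)"
    using gap_lim unfolding gap_def by (intro tendsto_intros)
  then have "\<forall>\<^sub>F k in sequentially. t * (2 * gap k * s) < 1" by (rule order_tendstoD(2)) simp
  then obtain k where k: "t * (2 * gap k * s) < 1"
    using eventually_happens'[OF sequentially_bot] by blast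
  define \<alpha> \<beta> where "\<alpha> = a k" and "\<beta> = a (Suc k)"
  have \<alpha>\<beta>: "0 < \<beta>" "\<beta> < \<alpha>" "0 < \<alpha>" using a_pos a_decr by (auto simp: \<alpha>_def \<beta>_def)
  define p where "p = (1 / \<alpha> + 1 / \<beta>) / 2"
  have p: "0 < p" "\<beta> * p < 1" "1 < \<alpha> * p" using \<alpha>\<beta> by (auto simp: p_def field_simps add_pos_pos)
  have "decseq a" using a_decr less_imp_le by (intro decseq_SucI) blast
  then have split: "a n \<le> \<beta> \<or> \<alpha> \<le> a n" for n
    unfolding \<alpha>_def \<beta>_def decseq_def by (metis not_less_eq_eq)
  have "AE x in \<nu>. x \<le> \<beta> \<or> \<alpha> \<le> x" unfolding \<nu>_def by (rule atomic_measure_AE) (measurable, rule split)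
  then have p_regular: "of_real p \<in> regular_points \<nu>" by (rule nu.regular_of_gap[OF p])
  have "p * nu.poisson (of_real p) = (\<integral>x. x * p / (1 - x * p)\<^sup>2 \<partial>\<nu>)"
    unfolding nu.poisson_def nu.cmod_one_minus power2_abs by (simp add: mult.commute flip: integral_mult_right_zero)
  also have "\<dots> \<le> (2 * gap k) * s" unfolding \<nu>_def s_def
  proof (rule integral_atomic_measure_le[OF w_pos _ _ _ w_inv_sum])
    show "a n * p / (1 - a n * p)\<^sup>2 \<le> 2 * gap k * inverse (a n)" for n
      using harmonic_mean_bound[OF \<alpha>\<beta>(1,2) a_pos split, of n] by (simp add: p_def gap_def \<alpha>_def \<beta>_def)
    show "0 \<le> a n * p / (1 - a n * p)\<^sup>2" for n using a_pos[of n] p by simp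
  qed measurable
  finally have "t * (p * nu.poisson (of_real p)) \<le> t * (2 * gap k * s)"
    using t_pos by (intro mult_left_mono) auto
  with k have p_small: "t * p * nu.poisson (of_real p) < 1" by (simp add: mult.assoc)
  have atoms: "measure \<nu> {\<alpha>} \<noteq> 0" "measure \<nu> {\<beta>} \<noteq> 0"
    unfolding \<nu>_def \<alpha>_def \<beta>_def using measure_atom_atomic_measure[OF w_pos w_sum] by auto
  show ?thesis
  proof (intro conjI allI impI)
    fix \<rho> assume conv: "is_free_mult_conv \<sigma> \<nu> \<rho>"
    then have "pos_prob \<rho>" by (simp add: is_free_mult_conv_def pos_prob_iff)
    moreover have "subordinated t \<nu> \<rho>"
      by (rule free_mult_BM_subordinated[OF \<sigma> conv nu.pos_prob_axioms])
    ultimately show "\<not> log_unimodal \<rho>"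
      using not_log_unimodal_if_split[OF nu.pos_prob_axioms _ _ t_pos p(1) p_regular p_small \<alpha>\<beta>(1) p(2) atoms(2) p(3) atoms(1)] by blast
  next
    fix \<rho> assume conv: "is_free_mult_conv \<sigma> (inv_measure \<nu>) \<rho>"
    then have rho: "pos_prob \<rho>" by (simp add: is_free_mult_conv_def pos_prob_iff)
    interpret inv: pos_prob "inv_measure \<nu>" by (rule nu.pos_prob_inv)
    have sub: "subordinated t (inv_measure \<nu>) \<rho>"
      by (rule free_mult_BM_subordinated[OF \<sigma> conv nu.pos_prob_inv])
    have reg: "of_real (1 / p) \<in> regular_points (inv_measure \<nu>)"
      using nu.regular_inv[OF p_regular] p(1) by simp
    have "1 / p * inv.poisson (of_real (1 / p)) = p * nu.poisson (of_real p)"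
      using nu.poisson_inv[OF p(1)] by simp
    then have small: "t * (1 / p) * inv.poisson (of_real (1 / p)) < 1" using p_small by (simp only: mult.assoc)
    show "\<not> log_unimodal \<rho>"
      by (rule not_log_unimodal_if_split[OF nu.pos_prob_inv rho sub t_pos _ reg small, of "1 / \<alpha>" "1 / \<beta>"])
        (use p \<alpha>\<beta> atoms nu.measure_inv_atom in \<open>auto simp: field_simps\<close>)
  qed
qed

end
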